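(* Assume that the model $\{P^{(n)}_{\theta,\eta}:\theta\in\Theta,\eta\in\mathcal H\}$ is endowed with the product prior $\Pi=\Pi_\Theta\times\Pi_{\mathcal H}$, where $\Pi_\Theta$ is thick at $\theta_0$, and $$P_0^{(n)}\,\Pi\big(\sqrt n|\theta-\theta_0|>M_n\mid X^{(n)}\big)\to0$$ for every real sequence $(M_n)$ with $M_n\to\infty$. Furthermore, suppose that for given sequences of uniformly tight random vectors $(\Delta_n)$ and non-random positive definite matrices $(V_n)$ satisfying $\liminf_{n\to\infty}\rho_{\min}(V_n)>0$, the integrated likelihood $$s_n(h)=\int_{\mathcal H}\frac{p^{(n)}_{\theta_n(h),\eta}}{p^{(n)}_{\theta_0,\eta_0}}(X^{(n)})\,d\Pi_{\mathcal H}(\eta)$$ satisfies $$\sup_{h\in K}\left|\log\frac{s_n(h)}{s_n(0)}-h^TV_n\Delta_n+\frac12h^TV_nh\right|=o_{P_0}(1)$$ for any compact $K\subset\mathbb R^p$. Then $$\sup_B\left|\Pi\big(\sqrt n(\theta-\theta_0)\in B\mid X^{(n)}\big)-N_{\Delta_n,V_n^{-1}}(B)\right|\to0$$ in $P_0^{(n)}$-probability, where the supremum is over all Borel sets $B\subset\mathbb R^p$.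
   Context: For each $n$, $\{P^{(n)}_{\theta,\eta}:\theta\in\Theta,\eta\in\mathcal H\}$ is a statistical model, $\Theta$ an open subset of $\mathbb R^p$, $\mathcal H$ a (possibly infinite-dimensional) parameter space; $P^{(n)}_{\theta,\eta}$ has density $p^{(n)}_{\theta,\eta}$ with respect to a $\sigma$-finite measure $\mu_n$. The observation $X^{(n)}$ follows $P_0^{(n)}=P^{(n)}_{\theta_0,\eta_0}$ for some $\theta_0\in\Theta$, $\eta_0\in\mathcal H$. $P_0^{(n)}Z$ denotes the expectation of $Z$ under $P_0^{(n)}$, and $o_{P_0}(1)$ denotes convergence to $0$ in $P_0^{(n)}$-probability (non-measurable quantities are handled via outer expectations). $\theta_n(h)=\theta_0+h/\sqrt n$ (which lies in $\Theta$ for $h$ in a given compact set and $n$ large). $\Pi_{\mathcal H}$ may depend on $n$; $\Pi(\cdot\mid X^{(n)})$ is the posterior given by Bayes' rule from the prior $\Pi_\Theta\times\Pi_{\mathcal H}$. $\Pi_\Theta$ is thick at $\theta_0$ if it has a positive continuous Lebesgue density in a neighborhood of $\theta_0$. $\rho_{\min}(A)$ is the minimum eigenvalue of $A$; $N_{\mu,\Sigma}$ is the multivariate normal distribution with mean $\mu$ and variance $\Sigma$. *)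

theory Defs
  imports "HOL-Probability.Probability"
begin

text \<open>
  A sequence of dominated models is given by dominating measures \<open>\<mu> n\<close> (whose spaces are the
  sample spaces and may vary with \<open>n\<close>) and densities \<open>p n \<theta> \<eta> x\<close>. The observation is the
  identity on the sample space, so a statistic is a function of the point \<open>x\<close>.
\<close>

definition model_law ::
  "(nat \<Rightarrow> 'x measure) \<Rightarrow> (nat \<Rightarrow> 'a \<Rightarrow> 'h \<Rightarrow> 'x \<Rightarrow> real) \<Rightarrow> nat \<Rightarrow> 'a \<Rightarrow> 'h \<Rightarrow> 'x measure"
  where "model_law \<mu> p n \<theta> \<eta> = density (\<mu> n) (\<lambda>x. ennreal (p n \<theta> \<eta> x))"

text \<open>
  The likelihood divided by the marginal density of the observation. Where the latter is
  \<open>0\<close> or \<open>\<infinity>\<close> Bayes' rule defines nothing, and the value below is the null measure.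
\<close>

definition posterior ::
  "(nat \<Rightarrow> 'a \<Rightarrow> 'h \<Rightarrow> 'x \<Rightarrow> real) \<Rightarrow> 'a measure \<Rightarrow> (nat \<Rightarrow> 'h measure) \<Rightarrow> nat \<Rightarrow> 'x \<Rightarrow> ('a \<times> 'h) measure"
  where "posterior p \<Pi>\<Theta> \<Pi>H n x =
    density (\<Pi>\<Theta> \<Otimes>\<^sub>M \<Pi>H n)
      (\<lambda>(\<theta>, \<eta>). ennreal (p n \<theta> \<eta> x) /
         (\<integral>\<^sup>+ (\<theta>', \<eta>'). ennreal (p n \<theta>' \<eta>' x) \<partial>(\<Pi>\<Theta> \<Otimes>\<^sub>M \<Pi>H n)))"

definition posterior_prob ::
  "(nat \<Rightarrow> 'a \<Rightarrow> 'h \<Rightarrow> 'x \<Rightarrow> real) \<Rightarrow> 'a measure \<Rightarrow> (nat \<Rightarrow> 'h measure) \<Rightarrow> nat \<Rightarrow> ('a \<Rightarrow> bool) \<Rightarrow> 'x \<Rightarrow> real"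
  where "posterior_prob p \<Pi>\<Theta> \<Pi>H n Q x =
    measure (posterior p \<Pi>\<Theta> \<Pi>H n x) {z \<in> space (\<Pi>\<Theta> \<Otimes>\<^sub>M \<Pi>H n). Q (fst z)}"

definition local_param :: "'a::real_vector \<Rightarrow> nat \<Rightarrow> 'a \<Rightarrow> 'a"
  where "local_param \<theta>0 n h = \<theta>0 + h /\<^sub>R sqrt (real n)"

definition integrated_likelihood ::
  "(nat \<Rightarrow> 'a::real_vector \<Rightarrow> 'h \<Rightarrow> 'x \<Rightarrow> real) \<Rightarrow> (nat \<Rightarrow> 'h measure) \<Rightarrow> 'a \<Rightarrow> 'h \<Rightarrow> nat \<Rightarrow> 'a \<Rightarrow> 'x \<Rightarrow> ennreal"
  where "integrated_likelihood p \<Pi>H \<theta>0 \<eta>0 n h x =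
    (\<integral>\<^sup>+ \<eta>. ennreal (p n (local_param \<theta>0 n h) \<eta> x / p n \<theta>0 \<eta>0 x) \<partial>\<Pi>H n)"

text \<open>
  The logarithm with values in the extended reals. If \<open>a\<close> or \<open>b\<close> is \<open>0\<close> or \<open>\<infinity>\<close>, then \<open>a / b\<close>
  in \<^typ>\<open>ennreal\<close> is again \<open>0\<close> or \<open>\<infinity>\<close>, so that the logarithm of a degenerate ratio of
  integrated likelihoods is always infinite.
\<close>

definition ln_ennreal :: "ennreal \<Rightarrow> ereal"
  where "ln_ennreal a = (if a = 0 then -\<infinity> else if a = \<top> then \<infinity> else ereal (ln (enn2real a)))"

definition thick_at :: "'a::euclidean_space measure \<Rightarrow> 'a \<Rightarrow> bool"
  where "thick_at Q \<theta>0 \<longleftrightarrow>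
    (\<exists>U f. open U \<and> \<theta>0 \<in> U \<and> U \<subseteq> space Q \<and> continuous_on U f \<and> (\<forall>\<theta>\<in>U. 0 < f \<theta>) \<and>
       (\<forall>A\<in>sets borel. A \<subseteq> U \<longrightarrow>
          emeasure Q A = (\<integral>\<^sup>+ \<theta>. ennreal (f \<theta>) * indicator A \<theta> \<partial>lborel)))"

definition tendsto_zero_in_outer_prob ::
  "(nat \<Rightarrow> 'x measure) \<Rightarrow> (nat \<Rightarrow> 'x \<Rightarrow> ennreal) \<Rightarrow> bool"
  where "tendsto_zero_in_outer_prob P Z \<longleftrightarrow>
    (\<forall>\<epsilon>>0. (\<lambda>n. outer_measure_of (P n) {x \<in> space (P n). ennreal \<epsilon> < Z n x}) \<longlonglongrightarrow> 0)"

definition uniformly_tight ::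
  "(nat \<Rightarrow> 'x measure) \<Rightarrow> (nat \<Rightarrow> 'x \<Rightarrow> 'a::real_normed_vector) \<Rightarrow> bool"
  where "uniformly_tight P \<Delta> \<longleftrightarrow>
    (\<forall>\<epsilon>>0. \<exists>M. \<forall>n. measure (P n) {x \<in> space (P n). M < norm (\<Delta> n x)} < \<epsilon>)"

definition positive_definite :: "real ^ 'p ^ 'p \<Rightarrow> bool"
  where "positive_definite A \<longleftrightarrow> transpose A = A \<and> (\<forall>v. v \<noteq> 0 \<longrightarrow> 0 < v \<bullet> (A *v v))"

definition min_eigenvalue :: "real ^ 'p ^ 'p \<Rightarrow> real"
  where "min_eigenvalue A = (LEAST l. \<exists>v. v \<noteq> 0 \<and> A *v v = l *\<^sub>R v)"

text \<open>The normal distribution with mean \<open>m\<close> and nonsingular covariance matrix \<open>S\<close>.\<close>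

definition multivariate_normal :: "real ^ 'p \<Rightarrow> real ^ 'p ^ 'p \<Rightarrow> (real ^ 'p) measure"
  where "multivariate_normal m S =
    density lborel (\<lambda>y. ennreal
      (exp (- ((y - m) \<bullet> (matrix_inv S *v (y - m))) / 2) / sqrt ((2 * pi) ^ CARD('p) * det S)))"

end

theory Submission
  imports Defs
begin

text \<open>
  Write \<open>h = \<surd>n (\<theta> - \<theta>\<^sub>0)\<close> for the rescaled parameter and fix a ball \<open>K\<close>. Because the prior is a
  product, integrating out \<open>\<eta>\<close> shows that the posterior of \<open>h\<close> has on \<open>K\<close> a density proportional to
  \<open>s\<^sub>n(h) f(\<theta>\<^sub>n(h))\<close>, with \<open>f\<close> the prior density near \<open>\<theta>\<^sub>0\<close>. By continuity \<open>f(\<theta>\<^sub>n(h))\<close> is nearly the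
  constant \<open>f(\<theta>\<^sub>0)\<close> on \<open>K\<close>, and by the expansion \<open>s\<^sub>n(h)\<close> is nearly
  \<open>s\<^sub>n(0) exp (h\<^sup>TV\<Delta> - h\<^sup>TVh/2)\<close>. Completing the square, this last function of \<open>h\<close> is a constant multiple of
  the density of \<open>N(\<Delta>, V\<^sup>-\<^sup>1)\<close>. Hence on \<open>K\<close> the posterior is, up to factors \<open>exp (\<plusminus>2a)\<close> with \<open>a\<close> small,
  a multiple of the normal law.

  The unknown multiple is determined by the total masses. If both probability measures give mass at
  least \<open>1 - a\<close> to \<open>K\<close>, the multiple is close to one and the two measures are close in total variation
  (lemma \<open>prob_close_if_proportional_on_large_set\<close>). The marginal likelihood and the
  normalising constants are thereby absorbed in the multiple, as soon as they are finite and positive.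

  A ball \<open>K\<close> of this kind exists for two reasons. The posterior tails vanish along every diverging
  sequence of radii, which forces a single radius to work for all large \<open>n\<close>
  (\<open>eventually_small_tail_beyond_fixed_level\<close>). The normal laws \<open>N(\<Delta>\<^sub>n, V\<^sub>n\<^sup>-\<^sup>1)\<close> are uniformly tight on the
  events \<open>|\<Delta>\<^sub>n| \<le> R\<close>, because they are images of one standard Gaussian measure under maps whose
  expansion is controlled by the smallest eigenvalue of \<open>V\<^sub>n\<close>
  (\<open>positive_definite_normal_representation\<close>). This representation, which also shows that the normal
  density integrates to one, rests on the spectral theorem and on the invariance of
  Lebesgue measure under orthogonal maps.

  All estimates are made for a fixed sample point. Probability enters only at the end, when the
  sample points at which one of the estimates fails are collected in four sets of small outer
  measure.
\<close>

section \<open>The spectral theorem for symmetric matrices\<close>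

lemma symmetric_matrix_inner:
  fixes V :: "real ^ 'p ^ 'p"
  assumes "transpose V = V"
  shows "x \<bullet> (V *v y) = (V *v x) \<bullet> y"
  using dot_lmul_matrix[of x V y] assms by (metis transpose_matrix_vector)

text \<open>
  A minimiser of the quadratic form on the unit sphere of the subspace is an eigenvector: the residual
  \<open>u = Vv - lv\<close> lies in the subspace, and moving from \<open>v\<close> against \<open>u\<close> would decrease the form to first
  order unless \<open>u = 0\<close>.
\<close>

lemma symmetric_matrix_eigenvector_in_subspace:
  fixes V :: "real ^ 'p ^ 'p"
  assumes sym: "transpose V = V" and W: "subspace W" and inv: "\<And>w. w \<in> W \<Longrightarrow> V *v w \<in> W"
    and ne: "W \<noteq> {0}"
  obtains v l where "v \<in> W" "norm v = 1" "V *v v = l *\<^sub>R v"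
proof -
  note adj = symmetric_matrix_inner[OF sym]
  let ?S = "W \<inter> sphere 0 1"
  have "compact ?S"
    using closed_subspace[OF W] by (intro closed_Int_compact) auto
  moreover have "?S \<noteq> {}"
  proof -
    obtain w where "w \<in> W" "w \<noteq> 0" using ne subspace_0[OF W] by auto
    then have "w /\<^sub>R norm w \<in> ?S" using W by (auto simp: subspace_scale)
    then show ?thesis by blast
  qed
  moreover have "continuous_on ?S (\<lambda>x. x \<bullet> (V *v x))"
    by (intro continuous_intros matrix_vector_mult_linear_continuous_on)
  ultimately obtain v where v: "v \<in> ?S" and vmin: "\<And>y. y \<in> ?S \<Longrightarrow> v \<bullet> (V *v v) \<le> y \<bullet> (V *v y)"
    using continuous_attains_inf[of ?S "\<lambda>x. x \<bullet> (V *v x)"] by blast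
  define l where "l = v \<bullet> (V *v v)"
  \<comment> \<open>Nonnegative on the subspace and zero at \<open>v\<close>, by minimality.\<close>
  define q where "q y = y \<bullet> (V *v y) - l * (y \<bullet> y)" for y
  have vv: "v \<bullet> v = 1" using v by (simp add: dot_square_norm)
  have q_nonneg: "0 \<le> q y" if "y \<in> W" for y
  proof (cases "y = 0")
    case False
    then have "y /\<^sub>R norm y \<in> ?S" using that W by (auto simp: subspace_scale)
    from vmin[OF this] have "l \<le> (y \<bullet> (V *v y)) / (norm y)\<^sup>2"
      by (simp add: l_def scaleR_matrix_vector_assoc[symmetric] matrix_vector_mult_scaleR power2_eq_square divide_simps mult.commute)
    with False show ?thesis by (simp add: q_def dot_square_norm field_simps)
  qed (simp add: q_def)
  define u where "u = V *v v - l *\<^sub>R v"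
  have uW: "u \<in> W" using v inv W by (auto simp: u_def intro!: subspace_diff subspace_scale)
  have exp: "q (v + t *\<^sub>R u) = t * (2 * (u \<bullet> u)) + t\<^sup>2 * q u" for t
  proof -
    have "q (v + t *\<^sub>R u) = q v + 2 * t * (u \<bullet> (V *v v) - l * (u \<bullet> v)) + t\<^sup>2 * q u"
      using adj[of v u]
      by (simp add: q_def matrix_vector_right_distrib matrix_vector_mult_scaleR inner_simps
          inner_commute power2_eq_square algebra_simps)
    moreover have "q v = 0" by (simp add: q_def l_def vv)
    moreover have "u \<bullet> (V *v v) - l * (u \<bullet> v) = u \<bullet> u" by (simp add: u_def inner_simps)
    ultimately show ?thesis by simp
  qed
  have "u \<bullet> u = 0"
  proof (rule ccontr)
    assume "u \<bullet> u \<noteq> 0"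
    then have pos: "0 < u \<bullet> u" by simp
    \<comment> \<open>So small that the second order term \<open>t\<^sup>2 q(u)\<close> cannot compensate the first order decrease.\<close>
    define t where "t = - (u \<bullet> u) / (q u + 1)"
    have qu: "0 \<le> q u" using q_nonneg uW by simp
    have tneg: "t < 0" using pos qu by (simp add: t_def divide_neg_pos)
    have "0 \<le> t * (2 * (u \<bullet> u) + t * q u)"
      using q_nonneg[of "v + t *\<^sub>R u"] v uW W exp[of t]
      by (simp add: subspace_add subspace_scale power2_eq_square algebra_simps)
    then have "2 * (u \<bullet> u) + t * q u \<le> 0" using tneg by (simp add: zero_le_mult_iff)
    moreover have "t * q u \<ge> - (u \<bullet> u)"
      using pos qu by (simp add: t_def field_simps)
    ultimately show False using pos by simp
  qed
  then have "V *v v = l *\<^sub>R v" by (simp add: u_def)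
  with v that show ?thesis by auto
qed

text \<open>
  A maximal orthonormal set of eigenvectors spans the space, since otherwise its orthogonal complement,
  which is invariant under the symmetric matrix, contains one more.
\<close>

lemma symmetric_matrix_orthonormal_eigenbasis:
  fixes V :: "real ^ 'p ^ 'p"
  assumes sym: "transpose V = V"
  obtains Q :: "real ^ 'p ^ 'p" and d :: "'p \<Rightarrow> real"
  where "orthogonal_matrix Q" "\<And>i. V *v column i Q = d i *\<^sub>R column i Q"
proof -
  note adj = symmetric_matrix_inner[OF sym]
  \<comment> \<open>Orthonormal sets of eigenvectors; their cardinality is bounded by the dimension.\<close>
  define ok where "ok S \<longleftrightarrow> pairwise orthogonal S \<and> (\<forall>v\<in>S. norm v = 1 \<and> (\<exists>l. V *v v = l *\<^sub>R v))"
    for S :: "(real ^ 'p) set"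
  have ind: "independent S" if "ok S" for S
    using that by (intro pairwise_orthogonal_independent) (auto simp: ok_def)
  have bound: "finite S \<and> card S \<le> CARD('p)" if "ok S" for S
    using independent_bound[OF ind[OF that]] by simp
  have "ok {}" by (simp add: ok_def)
  then obtain S where S: "ok S" and Smax: "\<And>T. ok T \<Longrightarrow> card T \<le> card S"
    using ex_has_greatest_nat[of ok "{}" card "Suc CARD('p)"] bound by (auto simp: less_Suc_eq_le)
  have "span S = UNIV"
  proof (rule ccontr)
    assume "span S \<noteq> UNIV"
    then have "span S \<subset> span UNIV" by auto
    then obtain x where x: "x \<noteq> 0" "\<And>y. y \<in> span S \<Longrightarrow> orthogonal x y"
      using orthogonal_to_subspace_exists_gen[of S UNIV] by auto
    let ?W = "{w. \<forall>s\<in>S. orthogonal s w}"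
    have "subspace ?W" by (auto simp: subspace_def orthogonal_def inner_simps)
    moreover have "V *v w \<in> ?W" if "w \<in> ?W" for w
    proof -
      have "s \<bullet> (V *v w) = 0" if "s \<in> S" for s
      proof -
        obtain l where "V *v s = l *\<^sub>R s" using \<open>s \<in> S\<close> S by (auto simp: ok_def)
        then show ?thesis using \<open>w \<in> ?W\<close> that by (simp add: adj orthogonal_def)
      qed
      then show ?thesis by (simp add: orthogonal_def)
    qed
    moreover have "?W \<noteq> {0}"
    proof -
      have "x \<in> ?W" using x(2) span_base by (auto simp: orthogonal_commute)
      with x(1) show ?thesis by blast
    qed
    ultimately obtain v l where v: "v \<in> ?W" "norm v = 1" "V *v v = l *\<^sub>R v"
      using symmetric_matrix_eigenvector_in_subspace[OF sym, of ?W] by blast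
    have "v \<notin> S"
    proof
      assume "v \<in> S"
      then have "v \<bullet> v = 0" using v by (auto simp: orthogonal_def)
      then show False using v by (simp add: dot_square_norm)
    qed
    moreover have "ok (insert v S)"
      using S v by (auto simp: ok_def pairwise_insert orthogonal_commute)
    ultimately show False using Smax[of "insert v S"] bound[OF S] by simp
  qed
  then have "card S = CARD('p)"
    using dim_eq_card_independent[OF ind[OF S]] by (metis dim_UNIV dim_span DIM_cart DIM_real mult.right_neutral)
  then obtain b :: "'p \<Rightarrow> real ^ 'p" where b: "bij_betw b UNIV S"
    using bound[OF S] by (metis finite_same_card_bij finite_UNIV finite)
  define Q where "Q = (\<chi> i j. b j $ i)"
  have col: "column j Q = b j" for j by (simp add: Q_def column_def vec_eq_iff)
  have bS: "b j \<in> S" for j using b by (auto simp: bij_betw_def)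
  have "\<exists>d. \<forall>j. V *v b j = d j *\<^sub>R b j"
    using S bS by (intro choice) (auto simp: ok_def)
  then obtain d where "\<And>j. V *v b j = d j *\<^sub>R b j" by auto
  moreover have "orthogonal_matrix Q"
    unfolding orthogonal_matrix_orthonormal_columns
  proof (intro conjI allI impI)
    show "norm (column i Q) = 1" for i using S bS by (auto simp: ok_def col)
    show "orthogonal (column i Q) (column j Q)" if "i \<noteq> j" for i j
    proof -
      have "b i \<noteq> b j" using b that by (auto simp: bij_betw_def inj_on_def)
      then show ?thesis using S bS by (auto simp: ok_def col pairwise_def)
    qed
  qed
  ultimately show ?thesis using that[of Q d] by (simp add: col)
qed

section \<open>Lebesgue measure under orthogonal and diagonal maps\<close>

lemma nn_integral_lborel_translate:
  fixes F :: "'a::euclidean_space \<Rightarrow> ennreal"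
  assumes [measurable]: "F \<in> borel_measurable borel"
  shows "(\<integral>\<^sup>+y. F (a + y) \<partial>lborel) = (\<integral>\<^sup>+y. F y \<partial>lborel)"
proof -
  have "(\<integral>\<^sup>+y. F y \<partial>lborel) = (\<integral>\<^sup>+y. F y \<partial>distr lborel borel ((+) a))"
    by (simp add: lborel_distr_plus)
  then show ?thesis by (simp add: nn_integral_distr)
qed

lemma nn_integral_lborel_reflect:
  fixes F :: "'a::euclidean_space \<Rightarrow> ennreal"
  assumes [measurable]: "F \<in> borel_measurable borel"
  shows "(\<integral>\<^sup>+y. F (a - y) \<partial>lborel) = (\<integral>\<^sup>+y. F y \<partial>lborel)"
proof -
  have "(\<integral>\<^sup>+y. F y \<partial>lborel) = (\<integral>\<^sup>+y. F y \<partial>density (distr lborel borel (\<lambda>x. a + (-1) *\<^sub>R x)) (\<lambda>_. ennreal (\<bar>-1\<bar>^DIM('a))))"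
    by (rule arg_cong[where f="\<lambda>M. integral\<^sup>N M F"]) (rule lborel_affine, simp)
  then show ?thesis by (simp add: nn_integral_density nn_integral_distr)
qed

text \<open>
  Let \<open>g\<close> be the indicator of the unit ball, for which the invariance is clear. Integrating
  \<open>F(x) g(x + Ty)\<close> over \<open>(x, y)\<close> first in \<open>y\<close> gives the volume of the ball times \<open>\<integral>F\<close>. Substituting
  \<open>x\<close> by \<open>x - Ty\<close> before integrating in \<open>y\<close> gives the same volume times \<open>\<integral>F(Ty) dy\<close>,
  by translation and reflection in \<open>y\<close>.
\<close>

lemma nn_integral_lborel_orthogonal:
  fixes F :: "'a::euclidean_space \<Rightarrow> ennreal" and T :: "'a \<Rightarrow> 'a"
  assumes T: "orthogonal_transformation T" and [measurable]: "F \<in> borel_measurable borel"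
  shows "(\<integral>\<^sup>+y. F (T y) \<partial>lborel) = (\<integral>\<^sup>+y. F y \<partial>lborel)"
proof -
  have lin: "linear T" using T by (rule orthogonal_transformation_linear)
  have [measurable]: "T \<in> borel_measurable borel"
    using lin by (intro borel_measurable_continuous_onI linear_continuous_on linear_conv_bounded_linear[THEN iffD1])
  define g :: "'a \<Rightarrow> ennreal" where "g = indicator (ball 0 1)"
  have [measurable]: "g \<in> borel_measurable borel"
    unfolding g_def by (intro borel_measurable_indicator borel_open open_ball)
  let ?c = "\<integral>\<^sup>+y. g y \<partial>lborel"
  have c: "?c \<noteq> 0" "?c \<noteq> \<infinity>"
    using emeasure_lborel_ball_finite[of 0 1] content_ball_pos[of 1 "0::'a"]
    by (auto simp: g_def measure_def)
  have gT: "g (T y) = g y" for y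
    using orthogonal_transformation_norm[OF T] by (simp add: g_def indicator_def)
  have surj: "\<exists>y. T y = x" for x
    using orthogonal_transformation_surj[OF T] by (metis surjD)
  have inner: "(\<integral>\<^sup>+y. g (x + T y) \<partial>lborel) = ?c" for x
  proof -
    obtain x' where "x = T x'" using surj by metis
    then have "g (x + T y) = g (x' + y)" for y using gT[of "x' + y"] lin by (simp add: linear_add)
    then show ?thesis by (simp add: nn_integral_lborel_translate)
  qed
  have outer: "(\<integral>\<^sup>+y. F (x - T y) \<partial>lborel) = (\<integral>\<^sup>+y. F (T y) \<partial>lborel)" for x
  proof -
    obtain x' where "x = T x'" using surj by metis
    then have "F (x - T y) = F (T (x' - y))" for y using lin by (simp add: linear_diff)
    then show ?thesis using nn_integral_lborel_reflect[of "\<lambda>y. F (T y)" x'] by simp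
  qed
  have "(\<integral>\<^sup>+x. F x \<partial>lborel) * ?c = (\<integral>\<^sup>+x. \<integral>\<^sup>+y. F x * g (x + T y) \<partial>lborel \<partial>lborel)"
    by (simp add: nn_integral_cmult inner nn_integral_multc)
  also have "\<dots> = (\<integral>\<^sup>+y. \<integral>\<^sup>+x. F x * g (x + T y) \<partial>lborel \<partial>lborel)"
    by (rule lborel_pair.Fubini') measurable
  also have "\<dots> = (\<integral>\<^sup>+y. \<integral>\<^sup>+x. F (x - T y) * g x \<partial>lborel \<partial>lborel)"
  proof (rule nn_integral_cong)
    fix y
    show "(\<integral>\<^sup>+x. F x * g (x + T y) \<partial>lborel) = (\<integral>\<^sup>+x. F (x - T y) * g x \<partial>lborel)"
      using nn_integral_lborel_translate[of "\<lambda>x. F (x - T y) * g x" "T y"] by (simp add: add.commute)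
  qed
  also have "\<dots> = (\<integral>\<^sup>+x. \<integral>\<^sup>+y. F (x - T y) * g x \<partial>lborel \<partial>lborel)"
    by (rule lborel_pair.Fubini') measurable
  also have "\<dots> = (\<integral>\<^sup>+y. F (T y) \<partial>lborel) * ?c"
    by (simp add: nn_integral_multc outer nn_integral_cmult)
  finally have "(\<integral>\<^sup>+x. F x \<partial>lborel) * ?c / ?c = (\<integral>\<^sup>+y. F (T y) \<partial>lborel) * ?c / ?c" by simp
  then show ?thesis using c by (simp add: ennreal_mult_divide_eq)
qed

lemma nn_integral_lborel_diagonal:
  fixes F :: "real ^ 'p \<Rightarrow> ennreal"
  assumes c: "\<And>i. 0 < c i" and [measurable]: "F \<in> borel_measurable borel"
  shows "(\<integral>\<^sup>+y. F y \<partial>lborel) = ennreal (\<Prod>i\<in>UNIV. c i) * (\<integral>\<^sup>+z. F (\<chi> i. c i * z $ i) \<partial>lborel)"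
proof -
  have B: "Basis = range (\<lambda>i::'p. axis i (1::real))"
    by (auto simp: Basis_vec_def)
  let ?c = "\<lambda>b. (\<chi> i. c i) \<bullet> b"
  have T: "0 + (\<Sum>j\<in>Basis. (?c j * (x \<bullet> j)) *\<^sub>R j) = (\<chi> i. c i * x $ i)" for x :: "real ^ 'p"
  proof (rule euclidean_eqI)
    fix b :: "real ^ 'p" assume b: "b \<in> Basis"
    then obtain k where "b = axis k 1" by (auto simp: B)
    then show "(0 + (\<Sum>j\<in>Basis. (?c j * (x \<bullet> j)) *\<^sub>R j)) \<bullet> b = (\<chi> i. c i * x $ i) \<bullet> b"
      unfolding add_0 inner_sum_left_Basis[OF b] by (simp add: inner_axis)
  qed
  have P: "(\<Prod>j\<in>Basis. \<bar>?c j\<bar>) = (\<Prod>i\<in>UNIV. c i)"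
    unfolding B using c by (subst prod.reindex) (auto simp: inj_on_def axis_eq_axis inner_axis less_imp_le)
  have [measurable]: "(\<lambda>x. \<chi> i. c i * x $ i) \<in> borel_measurable (borel :: (real ^ 'p) measure)"
    by (intro borel_measurable_continuous_onI continuous_intros)
  have "?c j \<noteq> 0" if "j \<in> Basis" for j
    using that c by (auto simp: B inner_axis less_imp_neq[THEN not_sym])
  then have "lborel = density (distr lborel borel (\<lambda>x::real ^ 'p. \<chi> i. c i * x $ i)) (\<lambda>_. \<Prod>i\<in>UNIV. c i)"
    using lborel_affine_euclidean[of ?c "0 :: real ^ 'p"] unfolding T P by blast
  then have "(\<integral>\<^sup>+y. F y \<partial>lborel) = (\<integral>\<^sup>+y. F y \<partial>density (distr lborel borel (\<lambda>x. \<chi> i. c i * x $ i)) (\<lambda>_. \<Prod>i\<in>UNIV. c i))"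
    by (rule arg_cong)
  then show ?thesis by (simp add: nn_integral_density nn_integral_distr nn_integral_cmult)
qed

section \<open>The normal distribution as an affine image of the standard Gaussian measure\<close>

definition std_gaussian :: "(real ^ 'p) measure"
  where "std_gaussian = density lborel (\<lambda>z. ennreal (exp (- (norm z)\<^sup>2 / 2) / sqrt ((2 * pi) ^ CARD('p))))"

lemma sets_std_gaussian [simp, measurable_cong]: "sets std_gaussian = sets borel"
  by (simp add: std_gaussian_def)

lemma prob_space_std_gaussian: "prob_space (std_gaussian :: (real ^ 'p) measure)"
proof
  have "exp (- (norm z)\<^sup>2 / 2) / sqrt ((2 * pi) ^ CARD('p)) = (\<Prod>b\<in>Basis. std_normal_density (z \<bullet> b))"
    for z :: "real ^ 'p"
  proof -
    have "(\<Prod>b\<in>(Basis :: (real ^ 'p) set). std_normal_density (z \<bullet> b)) =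
      (1 / sqrt (2 * pi)) ^ CARD('p) * exp (\<Sum>b\<in>Basis. - (z \<bullet> b)\<^sup>2 / 2)"
      unfolding std_normal_density_def by (simp add: prod.distrib exp_sum power_one_over prod_dividef)
    also have "(\<Sum>b\<in>(Basis :: (real ^ 'p) set). - (z \<bullet> b)\<^sup>2 / 2) = - (norm z)\<^sup>2 / 2"
      by (simp add: sum_negf sum_divide_distrib[symmetric] power2_norm_eq_inner euclidean_inner[of z z])
         (simp add: power2_eq_square)
    finally show ?thesis
      by (simp only: real_sqrt_power power_one_over divide_inverse mult_1 mult.commute power_inverse)
  qed
  then have "emeasure (std_gaussian :: (real ^ 'p) measure) UNIV =
      (\<integral>\<^sup>+z. (\<Prod>b\<in>Basis. ennreal (std_normal_density (z \<bullet> b))) \<partial>(lborel :: (real ^ 'p) measure))"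
    by (simp add: std_gaussian_def emeasure_density prod_ennreal)
  also have "\<dots> = (\<Prod>b\<in>(Basis :: (real ^ 'p) set). \<integral>\<^sup>+x. ennreal (std_normal_density x) \<partial>lborel)"
    by (rule nn_integral_lborel_prod) auto
  also have "(\<integral>\<^sup>+x. ennreal (std_normal_density x) \<partial>lborel) = 1"
    using prob_space.emeasure_space_1[OF prob_space_normal_density[of 1 0]] by (simp add: emeasure_density)
  finally show "emeasure std_gaussian (space (std_gaussian :: (real ^ 'p) measure)) = 1"
    by (simp add: std_gaussian_def)
qed

lemma matrix_inv_inverse:
  fixes A :: "real ^ 'p ^ 'p"
  assumes "invertible A"
  shows "A ** matrix_inv A = mat 1" "matrix_inv A ** A = mat 1"
  using someI_ex[OF assms[unfolded invertible_def]] by (simp_all add: matrix_inv_def)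

lemma matrix_inv_involution:
  fixes A :: "real ^ 'p ^ 'p"
  assumes "invertible A"
  shows "matrix_inv (matrix_inv A) = A"
proof -
  note A = matrix_inv_inverse[OF assms]
  then have "invertible (matrix_inv A)" by (auto simp: invertible_def)
  from matrix_inv_inverse(2)[OF this] A show ?thesis
    by (metis matrix_mul_assoc matrix_mul_lid matrix_mul_rid)
qed

text \<open>
  Take \<open>B = Q diag(d\<^sub>i\<^sup>-\<^sup>1\<^sup>/\<^sup>2)\<close> for an orthonormal eigenbasis \<open>Q\<close> of \<open>V\<close> with eigenvalues \<open>d\<^sub>i\<close>. Substituting
  \<open>y = m + Bz\<close> turns the quadratic form into \<open>|z|\<^sup>2\<close>, and the Jacobian \<open>\<Prod> d\<^sub>i\<^sup>-\<^sup>1\<^sup>/\<^sup>2\<close> is the determinant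
  factor of the normal density. Since every \<open>d\<^sub>i\<close> is at least the smallest eigenvalue of \<open>V\<close>, the map
  \<open>B\<close> stretches by at most the inverse square root of that eigenvalue, so that a lower bound on it
  makes all these laws tight at once.
\<close>

lemma positive_definite_normal_representation:
  fixes V :: "real ^ 'p ^ 'p"
  assumes V: "positive_definite V"
  obtains B :: "real ^ 'p ^ 'p" where
    "\<And>z. min_eigenvalue V * (norm (B *v z))\<^sup>2 \<le> (norm z)\<^sup>2"
    "\<And>m. multivariate_normal m (matrix_inv V) = distr std_gaussian borel (\<lambda>z. m + B *v z)"
proof -
  have sym: "transpose V = V" and pos: "\<And>v. v \<noteq> 0 \<Longrightarrow> 0 < v \<bullet> (V *v v)"
    using V by (auto simp: positive_definite_def)
  note adj = symmetric_matrix_inner[OF sym]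
  obtain Q d where Q: "orthogonal_matrix Q" and ev: "\<And>i. V *v column i Q = d i *\<^sub>R column i Q"
    using symmetric_matrix_orthonormal_eigenbasis[OF sym] by metis
  have nc: "norm (column i Q) = 1" for i
    using Q by (simp add: orthogonal_matrix_orthonormal_columns)
  have dpos: "0 < d i" for i
  proof -
    have "column i Q \<noteq> 0" using nc[of i] by (metis norm_zero zero_neq_one)
    from pos[OF this] show ?thesis using nc[of i] by (simp add: ev dot_square_norm)
  qed
  have eig: "(\<exists>v. v \<noteq> 0 \<and> V *v v = l *\<^sub>R v) \<longleftrightarrow> l \<in> range d" for l
  proof
    assume "\<exists>v. v \<noteq> 0 \<and> V *v v = l *\<^sub>R v"
    then obtain v where v: "v \<noteq> 0" "V *v v = l *\<^sub>R v" by auto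
    have "\<exists>i. v \<bullet> column i Q \<noteq> 0"
    proof (rule ccontr)
      assume "\<not> ?thesis"
      then have "transpose Q *v v = 0"
        by (simp add: vec_eq_iff matrix_vector_mult_def transpose_def column_def inner_vec_def mult.commute)
      then have "(Q ** transpose Q) *v v = 0" by (simp flip: matrix_vector_mul_assoc)
      then show False using Q v by (simp add: orthogonal_matrix_def)
    qed
    then obtain i where i: "v \<bullet> column i Q \<noteq> 0" by auto
    have "l * (v \<bullet> column i Q) = d i * (v \<bullet> column i Q)"
      using adj[of v "column i Q"] by (simp only: ev v(2) inner_scaleR_left inner_scaleR_right)
    with i show "l \<in> range d" by simp
  next
    assume "l \<in> range d"
    then show "\<exists>v. v \<noteq> 0 \<and> V *v v = l *\<^sub>R v" using ev nc by (metis imageE norm_zero zero_neq_one)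
  qed
  \<comment> \<open>The eigenvalues are exactly the \<open>d i\<close>, so the least one exists and is their minimum.\<close>
  have min_le: "min_eigenvalue V \<le> d i" for i
  proof -
    have "min_eigenvalue V = Min (range d)"
      unfolding min_eigenvalue_def eig by (subst Least_Min) (auto simp del: image_iff simp: full_SetCompr_eq)
    then show ?thesis by simp
  qed
  have VQ: "V *v (Q *v x) = Q *v (\<chi> i. d i * x $ i)" for x
    by (simp add: matrix_mult_sum[of Q] linear_sum[OF matrix_vector_mul_linear] matrix_vector_mult_scaleR
        ev scalar_mult_eq_scaleR mult.commute)
  have orth: "orthogonal_transformation ((*v) Q)"
    using Q by (simp add: orthogonal_transformation_matrix matrix_vector_mul_linear)
  have quad: "(Q *v x) \<bullet> (V *v (Q *v x)) = (\<Sum>i\<in>UNIV. d i * (x $ i)\<^sup>2)" for x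
    using orth by (simp add: VQ orthogonal_transformation_def inner_vec_def power2_eq_square mult_ac)
  have det: "det V = (\<Prod>i\<in>UNIV. d i)"
  proof -
    let ?D = "(\<chi> i j. if i = j then d i else 0) :: real ^ 'p ^ 'p"
    have "?D *v x = (\<chi> i. d i * x $ i)" for x
      by (simp add: vec_eq_iff matrix_vector_mult_def if_distrib[of "\<lambda>a. a * _"] cong: if_cong)
    then have "V ** Q = Q ** ?D"
      by (simp add: matrix_eq VQ flip: matrix_vector_mul_assoc)
    from arg_cong[OF this, of det] have "det V * det Q = det Q * det ?D" by (simp only: det_mul)
    moreover have "det Q \<noteq> 0" using det_orthogonal_matrix[OF Q] by auto
    moreover have "det ?D = (\<Prod>i\<in>UNIV. d i)" by (subst det_diagonal) auto
    ultimately show ?thesis by simp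
  qed
  then have detpos: "0 < det V" using dpos by (simp add: prod_pos)
  then have invV: "invertible V" by (simp add: invertible_det_nz)
  have detinv: "det (matrix_inv V) = 1 / det V"
    using arg_cong[OF matrix_inv_inverse(1)[OF invV], of det] detpos by (simp add: det_mul field_simps)
  define c where "c i = 1 / sqrt (d i)" for i
  have cpos: "0 < c i" for i using dpos by (simp add: c_def)
  have c2: "d i * (c i)\<^sup>2 = 1" for i using dpos[of i] by (simp add: c_def power_divide)
  define B where "B = Q ** (\<chi> i j. if i = j then c i else 0)"
  have Bz: "B *v z = Q *v (\<chi> i. c i * z $ i)" for z
  proof -
    have "(\<chi> i j. if i = j then c i else 0) *v z = (\<chi> i. c i * z $ i)"
      by (simp add: vec_eq_iff matrix_vector_mult_def if_distrib[of "\<lambda>a. a * _"] cong: if_cong)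
    then show ?thesis by (simp add: B_def flip: matrix_vector_mul_assoc)
  qed
  have sqn: "(norm x)\<^sup>2 = (\<Sum>i\<in>UNIV. (x $ i)\<^sup>2)" for x :: "real ^ 'p"
    by (simp add: power2_norm_eq_inner inner_vec_def) (simp add: power2_eq_square)
  show ?thesis
  proof
    fix z
    have "min_eigenvalue V * (norm (B *v z))\<^sup>2 = (\<Sum>i\<in>UNIV. min_eigenvalue V * (c i)\<^sup>2 * (z $ i)\<^sup>2)"
      using orthogonal_transformation_norm[OF orth] by (simp add: Bz sqn power_mult_distrib sum_distrib_left mult_ac)
    also have "\<dots> \<le> (\<Sum>i\<in>UNIV. (z $ i)\<^sup>2)"
    proof (rule sum_mono)
      fix i
      have "min_eigenvalue V * (c i)\<^sup>2 \<le> d i * (c i)\<^sup>2"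
        by (rule mult_right_mono[OF min_le]) simp
      then show "min_eigenvalue V * (c i)\<^sup>2 * (z $ i)\<^sup>2 \<le> (z $ i)\<^sup>2"
        using mult_right_mono[of "min_eigenvalue V * (c i)\<^sup>2" 1 "(z $ i)\<^sup>2"] by (simp add: c2)
    qed
    finally show "min_eigenvalue V * (norm (B *v z))\<^sup>2 \<le> (norm z)\<^sup>2" by (simp add: sqn)
  next
    fix m
    have mB [measurable]: "(\<lambda>z. m + B *v z) \<in> borel_measurable borel"
      by (intro borel_measurable_continuous_onI continuous_intros matrix_vector_mult_linear_continuous_on)
    have mV [measurable]: "(\<lambda>y. y \<bullet> (V *v y)) \<in> borel_measurable borel"
      by (intro borel_measurable_continuous_onI continuous_intros matrix_vector_mult_linear_continuous_on)
    have mV' [measurable]: "(\<lambda>y. (y - m) \<bullet> (V *v (y - m))) \<in> borel_measurable borel"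
      using mV by measurable
    define K where "K = sqrt ((2 * pi) ^ CARD('p) * det (matrix_inv V))"
    have K: "K = sqrt ((2 * pi) ^ CARD('p)) * (\<Prod>i\<in>UNIV. c i)"
    proof -
      have "sqrt (\<Prod>i\<in>I. d i) = (\<Prod>i\<in>I. sqrt (d i))" for I
        by (induction I rule: infinite_finite_induct) (simp_all add: real_sqrt_mult)
      then show ?thesis
        by (simp add: K_def detinv det c_def real_sqrt_mult real_sqrt_divide prod_dividef)
    qed
    have cp: "0 < (\<Prod>i\<in>UNIV. c i)" using cpos by (simp add: prod_pos)
    show "multivariate_normal m (matrix_inv V) = distr std_gaussian borel (\<lambda>z. m + B *v z)"
    proof (rule measure_eqI)
      fix A assume "A \<in> sets (multivariate_normal m (matrix_inv V))"
      then have [measurable]: "A \<in> sets borel" by (simp add: multivariate_normal_def)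
      have "emeasure (multivariate_normal m (matrix_inv V)) A =
          (\<integral>\<^sup>+y. ennreal (exp (- ((y - m) \<bullet> (V *v (y - m))) / 2) / K) * indicator A y \<partial>lborel)"
        by (simp add: multivariate_normal_def emeasure_density matrix_inv_involution[OF invV] K_def)
      also have "\<dots> = (\<integral>\<^sup>+y. ennreal (exp (- (y \<bullet> (V *v y)) / 2) / K) * indicator A (m + y) \<partial>lborel)"
        by (subst nn_integral_lborel_translate[of _ m, symmetric]) simp_all
      also have "\<dots> = (\<integral>\<^sup>+x. ennreal (exp (- ((Q *v x) \<bullet> (V *v (Q *v x))) / 2) / K) * indicator A (m + Q *v x) \<partial>lborel)"
        by (subst nn_integral_lborel_orthogonal[OF orth, symmetric]) simp_all
      also have "\<dots> = (\<integral>\<^sup>+x. ennreal (exp (- (\<Sum>i\<in>UNIV. d i * (x $ i)\<^sup>2) / 2) / K) * indicator A (m + Q *v x) \<partial>lborel)"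
        by (simp only: quad)
      also have "\<dots> = ennreal (\<Prod>i\<in>UNIV. c i) * (\<integral>\<^sup>+z. ennreal (exp (- (norm z)\<^sup>2 / 2) / K) * indicator A (m + B *v z) \<partial>lborel)"
      proof (subst nn_integral_lborel_diagonal[OF cpos])
        show "(\<lambda>x. ennreal (exp (- (\<Sum>i\<in>UNIV. d i * (x $ i)\<^sup>2) / 2) / K) * indicator A (m + Q *v x)) \<in> borel_measurable borel"
        proof -
          have [measurable]: "(\<lambda>z. m + Q *v z) \<in> borel_measurable borel"
            by (intro borel_measurable_continuous_onI continuous_intros matrix_vector_mult_linear_continuous_on)
          have [measurable]: "(\<lambda>x::real ^ 'p. \<Sum>i\<in>UNIV. d i * (x $ i)\<^sup>2) \<in> borel_measurable borel"
            by (intro borel_measurable_continuous_onI continuous_intros)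
          show ?thesis by measurable
        qed
        have "d i * (c i * z $ i)\<^sup>2 = (z $ i)\<^sup>2" for i and z :: "real ^ 'p"
          using c2[of i] by (metis mult.assoc mult.left_neutral power_mult_distrib)
        then show "ennreal (\<Prod>i\<in>UNIV. c i) * (\<integral>\<^sup>+z. ennreal (exp (- (\<Sum>i\<in>UNIV. d i * ((\<chi> i. c i * z $ i) $ i)\<^sup>2) / 2) / K) * indicator A (m + Q *v (\<chi> i. c i * z $ i)) \<partial>lborel) =
          ennreal (\<Prod>i\<in>UNIV. c i) * (\<integral>\<^sup>+z. ennreal (exp (- (norm z)\<^sup>2 / 2) / K) * indicator A (m + B *v z) \<partial>lborel)"
          by (simp add: Bz sqn)
      qed
      also have "\<dots> = (\<integral>\<^sup>+z. ennreal (exp (- (norm z)\<^sup>2 / 2) / sqrt ((2 * pi) ^ CARD('p))) * indicator A (m + B *v z) \<partial>lborel)"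
      proof (subst nn_integral_cmult[symmetric])
        show "(\<lambda>z. ennreal (exp (- (norm z)\<^sup>2 / 2) / K) * indicator A (m + B *v z)) \<in> borel_measurable lborel"
          by measurable
        have "ennreal (\<Prod>i\<in>UNIV. c i) * ennreal (t / K) = ennreal (t / sqrt ((2 * pi) ^ CARD('p)))" for t
          using cp less_imp_neq[OF cpos, symmetric] by (simp add: K flip: ennreal_mult')
        then show "(\<integral>\<^sup>+z. ennreal (\<Prod>i\<in>UNIV. c i) * (ennreal (exp (- (norm z)\<^sup>2 / 2) / K) * indicator A (m + B *v z)) \<partial>lborel) =
          (\<integral>\<^sup>+z. ennreal (exp (- (norm z)\<^sup>2 / 2) / sqrt ((2 * pi) ^ CARD('p))) * indicator A (m + B *v z) \<partial>lborel)"
          by (simp flip: mult.assoc)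
      qed
      also have "\<dots> = emeasure (distr std_gaussian borel (\<lambda>z. m + B *v z)) A"
      proof -
        have "(\<lambda>z. m + B *v z) -` A \<in> sets borel"
          using measurable_sets[OF mB, of A] by simp
        then show ?thesis
          by (simp add: emeasure_distr std_gaussian_def emeasure_density indicator_vimage[symmetric] indicator_def)
      qed
      finally show "emeasure (multivariate_normal m (matrix_inv V)) A = emeasure (distr std_gaussian borel (\<lambda>z. m + B *v z)) A" .
    qed (simp add: multivariate_normal_def)
  qed
qed

lemma prob_space_multivariate_normal:
  fixes V :: "real ^ 'p ^ 'p"
  assumes "positive_definite V"
  shows "prob_space (multivariate_normal m (matrix_inv V))"
proof -
  interpret G: prob_space "std_gaussian :: (real ^ 'p) measure" by (rule prob_space_std_gaussian)
  obtain B :: "real ^ 'p ^ 'p" where N: "multivariate_normal m (matrix_inv V) = distr std_gaussian borel (\<lambda>z. m + B *v z)"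
    using positive_definite_normal_representation[OF assms] by metis
  have "(\<lambda>z. m + B *v z) \<in> borel_measurable borel"
    by (intro borel_measurable_continuous_onI continuous_intros matrix_vector_mult_linear_continuous_on)
  then show ?thesis unfolding N by (intro G.prob_space_distr) simp
qed

text \<open>
  Completing the square: as functions of \<open>h\<close>, the normal density and the limiting likelihood ratio
  differ by the factor \<open>g\<close> only.
\<close>

lemma multivariate_normal_exponential_density:
  fixes V :: "real ^ 'p ^ 'p"
  assumes V: "positive_definite V"
  obtains g where "0 < g" "\<And>A. A \<in> sets borel \<Longrightarrow> emeasure (multivariate_normal m (matrix_inv V)) A =
    ennreal g * (\<integral>\<^sup>+h. ennreal (exp (h \<bullet> (V *v m) - 1 / 2 * (h \<bullet> (V *v h)))) * indicator A h \<partial>lborel)"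
proof -
  have sym: "transpose V = V" and pos: "\<And>v. v \<noteq> 0 \<Longrightarrow> 0 < v \<bullet> (V *v v)"
    using V by (auto simp: positive_definite_def)
  note adj = symmetric_matrix_inner[OF sym]
  interpret N: prob_space "multivariate_normal m (matrix_inv V)" by (rule prob_space_multivariate_normal[OF V])
  have "V *v x = 0 \<Longrightarrow> x = 0" for x using pos[of x] by force
  then have invV: "invertible V"
    by (simp add: invertible_left_inverse matrix_left_invertible_ker)
  define k where "k = sqrt ((2 * pi) ^ CARD('p) * det (matrix_inv V))"
  define g where "g = exp (- (m \<bullet> (V *v m)) / 2) / k"
  have q: "exp (- ((h - m) \<bullet> (V *v (h - m))) / 2) / k = g * exp (h \<bullet> (V *v m) - 1 / 2 * (h \<bullet> (V *v h)))" for h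
  proof -
    have "m \<bullet> (V *v h) = h \<bullet> (V *v m)" using adj[of m h] by (simp add: inner_commute)
    then have "- ((h - m) \<bullet> (V *v (h - m))) / 2 = - (m \<bullet> (V *v m)) / 2 + (h \<bullet> (V *v m) - 1 / 2 * (h \<bullet> (V *v h)))"
      by (simp add: matrix_vector_mult_diff_distrib inner_diff_left inner_diff_right field_simps)
    then show ?thesis unfolding g_def by (simp only: exp_add times_divide_eq_left)
  qed
  have mV [measurable]: "(\<lambda>h. exp (h \<bullet> (V *v m) - 1 / 2 * (h \<bullet> (V *v h)))) \<in> borel_measurable borel"
    by (intro borel_measurable_continuous_onI continuous_intros matrix_vector_mult_linear_continuous_on)
  have eq: "emeasure (multivariate_normal m (matrix_inv V)) A =
      (\<integral>\<^sup>+h. ennreal (g * exp (h \<bullet> (V *v m) - 1 / 2 * (h \<bullet> (V *v h)))) * indicator A h \<partial>lborel)"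
    if [measurable]: "A \<in> sets borel" for A
  proof -
    have "multivariate_normal m (matrix_inv V) =
      density lborel (\<lambda>h. ennreal (g * exp (h \<bullet> (V *v m) - 1 / 2 * (h \<bullet> (V *v h)))))"
      unfolding multivariate_normal_def matrix_inv_involution[OF invV] k_def[symmetric] q ..
    then show ?thesis by (simp only:) (rule emeasure_density; measurable)
  qed
  \<comment> \<open>A nonpositive factor would make the normal law the null measure.\<close>
  have g: "0 < g"
  proof (rule ccontr)
    assume "\<not> 0 < g"
    then have "ennreal (g * exp t) = 0" for t by (simp add: ennreal_eq_0_iff mult_nonpos_nonneg)
    then have "emeasure (multivariate_normal m (matrix_inv V)) UNIV = 0" by (simp add: eq)
    then show False using N.emeasure_space_1 by (simp add: multivariate_normal_def)
  qed
  show ?thesis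
  proof (rule that[OF g])
    fix A :: "(real ^ 'p) set" assume [measurable]: "A \<in> sets borel"
    show "emeasure (multivariate_normal m (matrix_inv V)) A =
    ennreal g * (\<integral>\<^sup>+h. ennreal (exp (h \<bullet> (V *v m) - 1 / 2 * (h \<bullet> (V *v h)))) * indicator A h \<partial>lborel)"
      using g by (subst nn_integral_cmult[symmetric]) (measurable, simp add: eq ennreal_mult' mult.assoc)
  qed
qed

text \<open>
  The radius \<open>k\<close> is chosen for the standard Gaussian measure. The affine map \<open>z \<mapsto> m + Bz\<close> carries the ball
  of radius \<open>k\<close> into the ball of radius \<open>R + k / \<surd>c\<close>.
\<close>

lemma multivariate_normal_uniform_tail:
  fixes c R e :: real
  assumes "0 < c" "0 < e"
  obtains M0 where "\<And>(V :: real ^ 'p ^ 'p) m M. positive_definite V \<Longrightarrow> c \<le> min_eigenvalue V \<Longrightarrow>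
    norm m \<le> R \<Longrightarrow> M0 \<le> M \<Longrightarrow> measure (multivariate_normal m (matrix_inv V)) (- cball 0 M) < e"
proof -
  interpret G: prob_space "std_gaussian :: (real ^ 'p) measure" by (rule prob_space_std_gaussian)
  have "(\<lambda>k. G.prob (cball 0 (real k))) \<longlonglongrightarrow> G.prob (\<Union>k. cball 0 (real k))"
    by (rule G.finite_Lim_measure_incseq) (auto simp: incseq_def)
  moreover have "(\<Union>k. cball (0 :: real ^ 'p) (real k)) = UNIV"
    using real_arch_simple by auto
  moreover have "G.prob UNIV = 1" using G.prob_space by (simp add: std_gaussian_def)
  ultimately have "\<forall>\<^sub>F k in sequentially. 1 - e < G.prob (cball 0 (real k))"
    using \<open>0 < e\<close> by (auto dest: order_tendstoD(1)[of _ _ _ "1 - e"])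
  then obtain k where k: "1 - e < G.prob (cball 0 (real k))"
    by (auto simp: eventually_sequentially)
  have tail: "G.prob (- cball 0 (real k)) < e"
    using k G.prob_compl[of "cball 0 (real k)"] by (simp add: Compl_eq_Diff_UNIV std_gaussian_def)
  show ?thesis
  proof (rule that[of "R + k / sqrt c"])
    fix V :: "real ^ 'p ^ 'p" and m :: "real ^ 'p" and M
    assume V: "positive_definite V" "c \<le> min_eigenvalue V" and m: "norm m \<le> R" and M: "R + k / sqrt c \<le> M"
    obtain B :: "real ^ 'p ^ 'p" where B: "\<And>z. min_eigenvalue V * (norm (B *v z))\<^sup>2 \<le> (norm z)\<^sup>2"
      and N: "\<And>m. multivariate_normal m (matrix_inv V) = distr std_gaussian borel (\<lambda>z. m + B *v z)"
      using positive_definite_normal_representation[OF V(1)] by blast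
    have mB [measurable]: "(\<lambda>z. m + B *v z) \<in> borel_measurable borel"
      by (intro borel_measurable_continuous_onI continuous_intros matrix_vector_mult_linear_continuous_on)
    have "(\<lambda>z. m + B *v z) -` (- cball 0 M) \<subseteq> - cball 0 (real k)"
    proof (intro subsetI ComplI)
      fix z assume z: "z \<in> (\<lambda>z. m + B *v z) -` (- cball 0 M)" "z \<in> cball 0 (real k)"
      then have "M < norm (m + B *v z)" by simp
      also have "\<dots> \<le> R + norm (B *v z)" using norm_triangle_ineq[of m "B *v z"] m by simp
      finally have "k / sqrt c < norm (B *v z)" using M by simp
      then have "real k < sqrt c * norm (B *v z)" using \<open>0 < c\<close> by (simp add: field_simps)
      then have "(real k)\<^sup>2 < c * (norm (B *v z))\<^sup>2"
        using \<open>0 < c\<close> power_strict_mono[of "real k" "sqrt c * norm (B *v z)" 2] by (simp add: power_mult_distrib)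
      also have "\<dots> \<le> (norm z)\<^sup>2"
        using B[of z] mult_right_mono[OF V(2), of "(norm (B *v z))\<^sup>2"] by simp
      finally have "real k < norm z" by (rule power_less_imp_less_base) simp
      then show False using z by simp
    qed
    then have "G.prob ((\<lambda>z. m + B *v z) -` (- cball 0 M)) \<le> G.prob (- cball 0 (real k))"
      by (intro G.finite_measure_mono) auto
    then show "measure (multivariate_normal m (matrix_inv V)) (- cball 0 M) < e"
      using tail by (simp add: N measure_distr std_gaussian_def)
  qed
qed

section \<open>Measures with nearly proportional densities\<close>

text \<open>
  The factor \<open>D\<close> of proportionality is arbitrary, but comparing the masses of \<open>K\<close> shows that it lies
  between \<open>exp (-a) (1 - e)\<close> and \<open>exp a / (1 - e)\<close>. So the ratio of the two measures on subsets of \<open>K\<close>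
  lies between \<open>1 / x\<close> and \<open>x\<close> with \<open>x = exp (2 a) / (1 - e)\<close>. The complement of \<open>K\<close> contributes the last
  summand \<open>e\<close>.
\<close>

lemma prob_close_if_proportional_on_large_set:
  fixes M N :: "'a measure" and a D e :: real
  assumes "prob_space M" "prob_space N" and sets: "sets M = sets N" and K: "K \<in> sets N"
    and tails: "measure M (space M - K) \<le> e" "measure N (space N - K) \<le> e" and "e < 1" and "0 \<le> a"
    and lower: "\<And>A. A \<in> sets N \<Longrightarrow> A \<subseteq> K \<Longrightarrow> exp (- a) * D * measure N A \<le> measure M A"
    and upper: "\<And>A. A \<in> sets N \<Longrightarrow> A \<subseteq> K \<Longrightarrow> measure M A \<le> exp a * D * measure N A"
    and B: "B \<in> sets N"
  shows "\<bar>measure M B - measure N B\<bar> \<le> exp (2 * a) / (1 - e) - 1 + e"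
proof -
  interpret M: prob_space M by fact
  interpret N: prob_space N by fact
  note [simp] = sets sets_eq_imp_space_eq[OF sets]
  have MK: "1 - e \<le> measure M K" "1 - e \<le> measure N K"
    using tails M.prob_compl[of K] N.prob_compl[of K] K by auto
  define x where "x = exp (2 * a) / (1 - e)"
  have x: "0 < x" using \<open>e < 1\<close> by (simp add: x_def)
  have "exp (- a) * D * (1 - e) \<le> 1 \<and> 0 < D"
  proof -
    have "0 < exp a * D * measure N K" using upper[of K] K MK \<open>e < 1\<close> by simp
    then have D: "0 < D" by (simp add: zero_less_mult_iff)
    have "exp (- a) * D * (1 - e) \<le> exp (- a) * D * measure N K"
      using D MK by (intro mult_left_mono) auto
    also have "\<dots> \<le> measure M K" using lower[of K] K by simp
    finally show ?thesis using D M.prob_le_1[of K] by linarith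
  qed
  then have D: "0 < D" and "exp (- a) * D * (1 - e) \<le> 1" by auto
  then have D1: "exp a * D \<le> x"
  proof -
    have "exp a * D * (1 - e) = exp (2 * a) * (exp (- a) * D * (1 - e))"
      by (simp flip: exp_add mult.assoc)
    also have "\<dots> \<le> exp (2 * a) * 1" by (intro mult_left_mono) (use \<open>exp (- a) * D * (1 - e) \<le> 1\<close> in auto)
    finally show ?thesis using \<open>e < 1\<close> by (simp add: x_def field_simps)
  qed
  have "1 - e \<le> exp a * D"
  proof -
    have "1 - e \<le> exp a * D * measure N K" using upper[of K] K MK by simp
    also have "\<dots> \<le> exp a * D * 1" using D by (intro mult_left_mono) auto
    finally show ?thesis by simp
  qed
  then have D2: "1 / x \<le> exp (- a) * D"
  proof -
    have "1 / x = exp (- (2 * a)) * (1 - e)" by (simp add: x_def exp_minus field_simps)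
    also have "\<dots> \<le> exp (- (2 * a)) * (exp a * D)"
      using \<open>1 - e \<le> exp a * D\<close> by (intro mult_left_mono) auto
    also have "\<dots> = exp (- a) * D" by (simp flip: exp_add mult.assoc)
    finally show ?thesis .
  qed
  have split: "measure M B \<le> measure M (B \<inter> K) + e" "measure N B \<le> measure N (B \<inter> K) + e"
  proof -
    have "measure M B \<le> measure M ((B \<inter> K) \<union> (space M - K))"
      using B K sets.sets_into_space[OF B] by (intro M.finite_measure_mono) auto
    also have "\<dots> \<le> measure M (B \<inter> K) + measure M (space M - K)"
      using B K by (intro measure_Un_le) auto
    finally show "measure M B \<le> measure M (B \<inter> K) + e" using tails by simp
    have "measure N B \<le> measure N ((B \<inter> K) \<union> (space N - K))"
      using B K sets.sets_into_space[OF B] by (intro N.finite_measure_mono) auto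
    also have "\<dots> \<le> measure N (B \<inter> K) + measure N (space N - K)"
      using B K by (intro measure_Un_le) auto
    finally show "measure N B \<le> measure N (B \<inter> K) + e" using tails by simp
  qed
  have mono: "measure M (B \<inter> K) \<le> measure M B" "measure N (B \<inter> K) \<le> measure N B"
    using B by (auto intro!: M.finite_measure_mono N.finite_measure_mono)
  have e0: "0 \<le> e" using tails(1) measure_nonneg order_trans by blast
  have "1 - e \<le> exp (2 * a)" using e0 \<open>0 \<le> a\<close> one_le_exp_iff[of "2 * a"] by linarith
  then have "1 \<le> x" using \<open>e < 1\<close> by (simp add: x_def)
  have "measure M B - measure N B \<le> x - 1 + e"
  proof -
    have "measure M B \<le> exp a * D * measure N (B \<inter> K) + e"
      using split(1) upper[of "B \<inter> K"] B K by auto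
    also have "\<dots> \<le> x * measure N B + e"
      using D1 mono(2) x by (intro add_right_mono mult_mono) auto
    finally have "measure M B - measure N B \<le> (x - 1) * measure N B + e" by (simp add: algebra_simps)
    also have "\<dots> \<le> (x - 1) * 1 + e" using \<open>1 \<le> x\<close> by (intro add_right_mono mult_left_mono) auto
    finally show ?thesis by simp
  qed
  moreover have "measure N B - measure M B \<le> x - 1 + e"
  proof -
    have "measure N B - measure M B \<le> measure N (B \<inter> K) + e - exp (- a) * D * measure N (B \<inter> K)"
      using split(2) mono(1) lower[of "B \<inter> K"] B K by auto
    also have "\<dots> \<le> measure N (B \<inter> K) + e - 1 / x * measure N (B \<inter> K)"
      using D2 by (intro diff_mono mult_right_mono) auto
    also have "\<dots> = (1 - 1 / x) * measure N (B \<inter> K) + e" by (simp add: algebra_simps)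
    also have "\<dots> \<le> (1 - 1 / x) * 1 + e" using \<open>1 \<le> x\<close> by (intro add_right_mono mult_left_mono) auto
    also have "\<dots> \<le> x - 1 + e"
    proof -
      have "0 \<le> (x - 1)\<^sup>2 / x" using x by simp
      also have "\<dots> = x - 1 - (1 - 1 / x)" using x by (simp add: power2_eq_square field_simps)
      finally show ?thesis by simp
    qed
    finally show ?thesis .
  qed
  ultimately show ?thesis by (simp add: x_def)
qed

section \<open>A product prior in the rescaled parameter\<close>

text \<open>
  The prior is only known to have the density \<open>f\<close> on \<open>U\<close>, and \<open>\<phi>\<close> need not be measurable as a function on
  the whole space. Multiplying by the indicator of \<open>A \<subseteq> U\<close> repairs both.
\<close>

lemma nn_integral_local_density:
  fixes Q :: "'a::euclidean_space measure" and f :: "'a \<Rightarrow> real"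
  assumes \<Theta>: "open \<Theta>" and Q: "sets Q = sets (restrict_space borel \<Theta>)"
    and U: "open U" "U \<subseteq> \<Theta>" and f: "continuous_on U f"
    and dens: "\<And>A. A \<in> sets borel \<Longrightarrow> A \<subseteq> U \<Longrightarrow>
      emeasure Q A = (\<integral>\<^sup>+\<theta>. ennreal (f \<theta>) * indicator A \<theta> \<partial>lborel)"
    and A: "A \<in> sets borel" "A \<subseteq> U" and \<phi>: "\<phi> \<in> borel_measurable Q"
  shows "(\<integral>\<^sup>+\<theta>. \<phi> \<theta> * indicator A \<theta> \<partial>Q) = (\<integral>\<^sup>+\<theta>. ennreal (f \<theta>) * (\<phi> \<theta> * indicator A \<theta>) \<partial>lborel)"
    and "(\<lambda>\<theta>. \<phi> \<theta> * indicator A \<theta>) \<in> borel_measurable borel"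
    and "(\<lambda>\<theta>. ennreal (f \<theta>) * indicator A \<theta>) \<in> borel_measurable borel"
proof -
  have [measurable]: "A \<in> sets borel" "\<Theta> \<in> sets borel" "U \<in> sets borel" using A \<Theta> U by auto
  have spQ: "space Q = \<Theta>" using sets_eq_imp_space_eq[OF Q] by (simp add: space_restrict_space)
  have "\<phi> \<in> borel_measurable (restrict_space borel \<Theta>)"
    using \<phi> measurable_cong_sets[OF Q refl] by auto
  then have "(\<lambda>\<theta>. \<phi> \<theta> * indicator \<Theta> \<theta>) \<in> borel_measurable borel"
    by (subst (asm) borel_measurable_restrict_space_iff_ennreal) auto
  then have "(\<lambda>\<theta>. \<phi> \<theta> * indicator \<Theta> \<theta> * indicator A \<theta>) \<in> borel_measurable borel" by measurable
  also have "(\<lambda>\<theta>. \<phi> \<theta> * indicator \<Theta> \<theta> * indicator A \<theta>) = (\<lambda>\<theta>. \<phi> \<theta> * indicator A \<theta>)"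
    using A U by (auto simp: fun_eq_iff indicator_def)
  finally show m [measurable]: "(\<lambda>\<theta>. \<phi> \<theta> * indicator A \<theta>) \<in> borel_measurable borel" .
  have "(\<lambda>\<theta>. indicator U \<theta> *\<^sub>R f \<theta>) \<in> borel_measurable borel"
    using f U by (intro borel_measurable_continuous_on_indicator) auto
  then have fm: "(\<lambda>\<theta>. ennreal (indicator U \<theta> *\<^sub>R f \<theta>)) \<in> borel_measurable borel" by measurable
  then have "(\<lambda>\<theta>. ennreal (indicator U \<theta> *\<^sub>R f \<theta>) * indicator A \<theta>) \<in> borel_measurable borel" by measurable
  also have "(\<lambda>\<theta>. ennreal (indicator U \<theta> *\<^sub>R f \<theta>) * indicator A \<theta>) = (\<lambda>\<theta>. ennreal (f \<theta>) * indicator A \<theta>)"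
    using A by (auto simp: fun_eq_iff indicator_def)
  finally show "(\<lambda>\<theta>. ennreal (f \<theta>) * indicator A \<theta>) \<in> borel_measurable borel" .
  have [measurable]: "(\<lambda>\<theta>. \<theta>) \<in> Q \<rightarrow>\<^sub>M borel"
    unfolding measurable_cong_sets[OF Q refl] by (intro measurable_restrict_space1) simp
  have *: "density (distr Q borel (\<lambda>\<theta>. \<theta>)) (indicator U) = density lborel (\<lambda>\<theta>. ennreal (indicator U \<theta> *\<^sub>R f \<theta>))"
  proof (rule measure_eqI)
    fix B assume "B \<in> sets (density (distr Q borel (\<lambda>\<theta>. \<theta>)) (indicator U))"
    then have B [measurable]: "B \<in> sets borel" by simp
    have "emeasure (density (distr Q borel (\<lambda>\<theta>. \<theta>)) (indicator U)) B = emeasure (distr Q borel (\<lambda>\<theta>. \<theta>)) (U \<inter> B)"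
      by (simp add: emeasure_density flip: indicator_inter_arith)
    also have "\<dots> = emeasure Q (U \<inter> B)"
      using U by (simp add: emeasure_distr spQ Int_absorb2 le_infI1)
    also have "\<dots> = (\<integral>\<^sup>+\<theta>. ennreal (f \<theta>) * indicator (U \<inter> B) \<theta> \<partial>lborel)"
      by (rule dens) auto
    also have "\<dots> = (\<integral>\<^sup>+\<theta>. ennreal (indicator U \<theta> *\<^sub>R f \<theta>) * indicator B \<theta> \<partial>lborel)"
      by (intro nn_integral_cong) (auto simp: indicator_def)
    also have "\<dots> = emeasure (density lborel (\<lambda>\<theta>. ennreal (indicator U \<theta> *\<^sub>R f \<theta>))) B"
      using fm by (subst emeasure_density) auto
    finally show "emeasure (density (distr Q borel (\<lambda>\<theta>. \<theta>)) (indicator U)) B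
      = emeasure (density lborel (\<lambda>\<theta>. ennreal (indicator U \<theta> *\<^sub>R f \<theta>))) B" .
  qed simp
  have "(\<integral>\<^sup>+\<theta>. \<phi> \<theta> * indicator A \<theta> \<partial>Q) = (\<integral>\<^sup>+\<theta>. \<phi> \<theta> * indicator A \<theta> \<partial>distr Q borel (\<lambda>\<theta>. \<theta>))"
    by (simp add: nn_integral_distr)
  also have "\<dots> = (\<integral>\<^sup>+\<theta>. indicator U \<theta> * (\<phi> \<theta> * indicator A \<theta>) \<partial>distr Q borel (\<lambda>\<theta>. \<theta>))"
    using A by (intro nn_integral_cong) (auto simp: indicator_def)
  also have "\<dots> = (\<integral>\<^sup>+\<theta>. \<phi> \<theta> * indicator A \<theta> \<partial>density (distr Q borel (\<lambda>\<theta>. \<theta>)) (indicator U))"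
    by (subst nn_integral_density) auto
  also have "\<dots> = (\<integral>\<^sup>+\<theta>. ennreal (indicator U \<theta> *\<^sub>R f \<theta>) * (\<phi> \<theta> * indicator A \<theta>) \<partial>lborel)"
    unfolding * using fm by (subst nn_integral_density) auto
  also have "\<dots> = (\<integral>\<^sup>+\<theta>. ennreal (f \<theta>) * (\<phi> \<theta> * indicator A \<theta>) \<partial>lborel)"
    using A by (intro nn_integral_cong) (auto simp: indicator_def)
  finally show "(\<integral>\<^sup>+\<theta>. \<phi> \<theta> * indicator A \<theta> \<partial>Q) = (\<integral>\<^sup>+\<theta>. ennreal (f \<theta>) * (\<phi> \<theta> * indicator A \<theta>) \<partial>lborel)" .
qed

text \<open>
  Fubini and the substitution \<open>\<theta> = \<theta>\<^sub>0 + h / c\<close>. With \<open>c = \<surd>n\<close> and \<open>L\<close> the likelihood, the integrand on the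
  right is the prior density times the integrated likelihood at the local parameter \<open>h\<close>.
\<close>

lemma nn_integral_rescaled_product_prior:
  fixes Q :: "'a::euclidean_space measure" and f :: "'a \<Rightarrow> real" and c :: real
  assumes R: "sigma_finite_measure R" and \<Theta>: "open \<Theta>" and Q: "sets Q = sets (restrict_space borel \<Theta>)"
    and U: "open U" "U \<subseteq> \<Theta>" and f: "continuous_on U f"
    and dens: "\<And>A. A \<in> sets borel \<Longrightarrow> A \<subseteq> U \<Longrightarrow>
      emeasure Q A = (\<integral>\<^sup>+\<theta>. ennreal (f \<theta>) * indicator A \<theta> \<partial>lborel)"
    and L [measurable]: "L \<in> borel_measurable (Q \<Otimes>\<^sub>M R)" and c: "0 < c"
    and A [measurable]: "A \<in> sets borel" and AU: "\<And>h. h \<in> A \<Longrightarrow> \<theta>0 + h /\<^sub>R c \<in> U"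
  shows "(\<integral>\<^sup>+z. L z * indicator A (c *\<^sub>R (fst z - \<theta>0)) \<partial>(Q \<Otimes>\<^sub>M R)) =
    ennreal (inverse c ^ DIM('a)) *
      (\<integral>\<^sup>+h. ennreal (f (\<theta>0 + h /\<^sub>R c)) * (\<integral>\<^sup>+\<eta>. L (\<theta>0 + h /\<^sub>R c, \<eta>) \<partial>R) * indicator A h \<partial>lborel)"
proof -
  interpret R: sigma_finite_measure R by fact
  let ?A = "(\<lambda>\<theta>. c *\<^sub>R (\<theta> - \<theta>0)) -` A"
  let ?\<phi> = "\<lambda>\<theta>. \<integral>\<^sup>+\<eta>. L (\<theta>, \<eta>) \<partial>R"
  have [measurable]: "(\<lambda>\<theta>. c *\<^sub>R (\<theta> - \<theta>0)) \<in> borel_measurable borel" by measurable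
  then have A' [measurable]: "?A \<in> sets borel" using measurable_sets[of _ borel borel A] by fastforce
  have "?A \<subseteq> U"
  proof
    fix \<theta> assume "\<theta> \<in> ?A"
    then show "\<theta> \<in> U" using AU[of "c *\<^sub>R (\<theta> - \<theta>0)"] c by simp
  qed
  have \<phi> [measurable]: "?\<phi> \<in> borel_measurable Q" by measurable
  note loc = nn_integral_local_density[OF \<Theta> Q U f dens A' \<open>?A \<subseteq> U\<close> \<phi>, simplified]
  have idQ: "(\<lambda>\<theta>. \<theta>) \<in> Q \<rightarrow>\<^sub>M borel"
    unfolding measurable_cong_sets[OF Q refl] by (intro measurable_restrict_space1) simp
  have [measurable]: "fst \<in> Q \<Otimes>\<^sub>M R \<rightarrow>\<^sub>M borel"
    using measurable_compose[OF measurable_fst[of Q R] idQ] by simp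
  have "(\<integral>\<^sup>+z. L z * indicator A (c *\<^sub>R (fst z - \<theta>0)) \<partial>(Q \<Otimes>\<^sub>M R)) =
      (\<integral>\<^sup>+\<theta>. \<integral>\<^sup>+\<eta>. L (\<theta>, \<eta>) * indicator A (c *\<^sub>R (\<theta> - \<theta>0)) \<partial>R \<partial>Q)"
    by (subst R.nn_integral_fst[symmetric]) simp_all
  also have "\<dots> = (\<integral>\<^sup>+\<theta>. ?\<phi> \<theta> * indicator ?A \<theta> \<partial>Q)"
    by (intro nn_integral_cong) (simp add: nn_integral_multc indicator_vimage[symmetric] indicator_def vimage_def)
  also have "\<dots> = (\<integral>\<^sup>+\<theta>. ennreal (f \<theta>) * (?\<phi> \<theta> * indicator ?A \<theta>) \<partial>lborel)"
    by (rule loc(1))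
  also have "\<dots> = (\<integral>\<^sup>+\<theta>. (ennreal (f \<theta>) * indicator ?A \<theta>) * (?\<phi> \<theta> * indicator ?A \<theta>) \<partial>lborel)" (is "_ = (\<integral>\<^sup>+\<theta>. ?G \<theta> \<partial>lborel)")
    by (intro nn_integral_cong) (auto simp: indicator_def)
  also have "\<dots> = (\<integral>\<^sup>+\<theta>. ?G \<theta> \<partial>density (distr lborel borel (\<lambda>x. \<theta>0 + inverse c *\<^sub>R x)) (\<lambda>_. ennreal (\<bar>inverse c\<bar> ^ DIM('a))))"
    using c by (intro arg_cong[where f="\<lambda>M. integral\<^sup>N M ?G"] lborel_affine) simp
  also have "\<dots> = (\<integral>\<^sup>+h. ennreal (inverse c ^ DIM('a)) * ?G (\<theta>0 + inverse c *\<^sub>R h) \<partial>lborel)"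
  proof -
    have [measurable]: "?G \<in> borel_measurable borel"
      by (rule borel_measurable_times_ennreal[OF loc(3,2)])
    then show ?thesis using c by (subst nn_integral_density; simp add: nn_integral_distr)
  qed
  also have "\<dots> = ennreal (inverse c ^ DIM('a)) * (\<integral>\<^sup>+h. ?G (\<theta>0 + inverse c *\<^sub>R h) \<partial>lborel)"
  proof (rule nn_integral_cmult)
    have "?G \<in> borel_measurable borel"
      by (rule borel_measurable_times_ennreal[OF loc(3,2)])
    moreover have "(\<lambda>h. \<theta>0 + inverse c *\<^sub>R h) \<in> lborel \<rightarrow>\<^sub>M borel" by measurable
    ultimately show "(\<lambda>h. ?G (\<theta>0 + inverse c *\<^sub>R h)) \<in> borel_measurable lborel"
      by (rule measurable_compose[rotated])
  qed
  also have "(\<integral>\<^sup>+h. ?G (\<theta>0 + inverse c *\<^sub>R h) \<partial>lborel) =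
      (\<integral>\<^sup>+h. ennreal (f (\<theta>0 + h /\<^sub>R c)) * (\<integral>\<^sup>+\<eta>. L (\<theta>0 + h /\<^sub>R c, \<eta>) \<partial>R) * indicator A h \<partial>lborel)"
    using c by (intro nn_integral_cong) (auto simp: indicator_def mult.commute)
  finally show ?thesis .
qed

text \<open>
  The law of \<open>c (\<theta> - \<theta>\<^sub>0)\<close> under the posterior for the prior \<open>P\<close> and the likelihood function \<open>L\<close>. As
  a measure on the parameter space alone it can be compared with a normal law.
\<close>

definition rescaled_posterior :: "('a::euclidean_space \<times> 'h) measure \<Rightarrow> 'a \<Rightarrow> real \<Rightarrow> ('a \<times> 'h \<Rightarrow> ennreal) \<Rightarrow> 'a measure"
  where "rescaled_posterior P \<theta>0 c L =
    distr (density P (\<lambda>z. L z / (\<integral>\<^sup>+z. L z \<partial>P))) borel (\<lambda>z. c *\<^sub>R (fst z - \<theta>0))"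

text \<open>
  The two factors of the prior, with the density \<open>f\<close> of the first one near the true parameter: what
  the posterior of a single experiment depends on besides the likelihood.
\<close>

locale thick_product_prior =
  fixes \<Theta> U :: "'a::euclidean_space set" and f :: "'a \<Rightarrow> real" and Q :: "'a measure" and R :: "'h measure"
  assumes open_param: "open \<Theta>" and sets_Q: "sets Q = sets (restrict_space borel \<Theta>)"
    and prob_Q: "prob_space Q" and prob_R: "prob_space R"
    and U: "open U" "U \<subseteq> \<Theta>" and f: "continuous_on U f"
    and dens: "\<And>A. A \<in> sets borel \<Longrightarrow> A \<subseteq> U \<Longrightarrow>
      emeasure Q A = (\<integral>\<^sup>+\<theta>. ennreal (f \<theta>) * indicator A \<theta> \<partial>lborel)"
begin

lemma measurable_ident_Q: "(\<lambda>\<theta>. \<theta>) \<in> Q \<rightarrow>\<^sub>M borel"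
  unfolding measurable_cong_sets[OF sets_Q refl] by (intro measurable_restrict_space1) simp

lemma measurable_rescale [measurable]: "(\<lambda>z. c *\<^sub>R (fst z - \<theta>0)) \<in> borel_measurable (Q \<Otimes>\<^sub>M R)"
proof -
  have [measurable]: "fst \<in> Q \<Otimes>\<^sub>M R \<rightarrow>\<^sub>M borel"
    using measurable_compose[OF measurable_fst[of Q R] measurable_ident_Q] by simp
  show ?thesis by measurable
qed

lemma emeasure_rescaled_posterior:
  assumes [measurable]: "L \<in> borel_measurable (Q \<Otimes>\<^sub>M R)" "A \<in> sets borel"
  shows "emeasure (rescaled_posterior (Q \<Otimes>\<^sub>M R) \<theta>0 c L) A =
    (\<integral>\<^sup>+z. L z * indicator A (c *\<^sub>R (fst z - \<theta>0)) \<partial>(Q \<Otimes>\<^sub>M R)) / (\<integral>\<^sup>+z. L z \<partial>(Q \<Otimes>\<^sub>M R))"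
proof -
  let ?m = "\<integral>\<^sup>+z. L z \<partial>(Q \<Otimes>\<^sub>M R)"
  have "emeasure (rescaled_posterior (Q \<Otimes>\<^sub>M R) \<theta>0 c L) A = 
    (\<integral>\<^sup>+z. L z / ?m * indicator ((\<lambda>z. c *\<^sub>R (fst z - \<theta>0)) -` A \<inter> space (Q \<Otimes>\<^sub>M R)) z \<partial>(Q \<Otimes>\<^sub>M R))"
    unfolding rescaled_posterior_def
    by (subst emeasure_distr) (simp_all add: emeasure_density)
  also have "\<dots> = (\<integral>\<^sup>+z. L z * indicator A (c *\<^sub>R (fst z - \<theta>0)) / ?m \<partial>(Q \<Otimes>\<^sub>M R))"
    by (intro nn_integral_cong) (auto simp: indicator_def)
  also have "\<dots> = (\<integral>\<^sup>+z. L z * indicator A (c *\<^sub>R (fst z - \<theta>0)) \<partial>(Q \<Otimes>\<^sub>M R)) / ?m"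
    by (rule nn_integral_divide) measurable
  finally show ?thesis .
qed

text \<open>
  The prior density and the integrated likelihood contribute a relative error \<open>exp (\<plusminus>a)\<close> each. The
  constants \<open>c\<^sup>-\<^sup>d\<close> (Jacobian), \<open>b\<close> (prior density at the centre), \<open>s\<close> (likelihood at the centre) and
  \<open>g\<close> (normalisation of the normal law) are collected in \<open>D\<close>.
\<close>

lemma likelihood_mass_proportional:
  fixes w :: "'a \<Rightarrow> real" and a b c g s :: real
  assumes L [measurable]: "L \<in> borel_measurable (Q \<Otimes>\<^sub>M R)" and c: "0 < c"
    and KU: "\<And>h. h \<in> K \<Longrightarrow> \<theta>0 + h /\<^sub>R c \<in> U"
    and pos: "0 < b" "0 < g" "0 < s"
    and f_bounds: "\<And>h. h \<in> K \<Longrightarrow> exp (- a) * b \<le> f (\<theta>0 + h /\<^sub>R c)"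
      "\<And>h. h \<in> K \<Longrightarrow> f (\<theta>0 + h /\<^sub>R c) \<le> exp a * b"
    and L_bounds: "\<And>h. h \<in> K \<Longrightarrow> ennreal (exp (- a) * s * w h) \<le> (\<integral>\<^sup>+\<eta>. L (\<theta>0 + h /\<^sub>R c, \<eta>) \<partial>R)"
      "\<And>h. h \<in> K \<Longrightarrow> (\<integral>\<^sup>+\<eta>. L (\<theta>0 + h /\<^sub>R c, \<eta>) \<partial>R) \<le> ennreal (exp a * s * w h)"
    and w [measurable]: "w \<in> borel_measurable borel" and w_pos: "\<And>h. 0 \<le> w h"
    and N: "\<And>A. A \<in> sets borel \<Longrightarrow> emeasure N A = ennreal g * (\<integral>\<^sup>+h. ennreal (w h) * indicator A h \<partial>lborel)"
  obtains D where "0 < D"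
    "\<And>A. A \<in> sets borel \<Longrightarrow> A \<subseteq> K \<Longrightarrow> ennreal (exp (- (2 * a)) * D) * emeasure N A
      \<le> (\<integral>\<^sup>+z. L z * indicator A (c *\<^sub>R (fst z - \<theta>0)) \<partial>(Q \<Otimes>\<^sub>M R))"
    "\<And>A. A \<in> sets borel \<Longrightarrow> A \<subseteq> K \<Longrightarrow> (\<integral>\<^sup>+z. L z * indicator A (c *\<^sub>R (fst z - \<theta>0)) \<partial>(Q \<Otimes>\<^sub>M R))
      \<le> ennreal (exp (2 * a) * D) * emeasure N A"
proof -
  interpret R: prob_space R by (rule prob_R)
  define k where "k = inverse c ^ DIM('a)"
  have k: "0 < k" using c by (simp add: k_def)
  define D where "D = k * b * s / g"
  have D: "0 < D" using pos k by (simp add: D_def)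
  have DN: "ennreal (t * D) * emeasure N A = ennreal k * (\<integral>\<^sup>+h. ennreal (t * b * s * w h) * indicator A h \<partial>lborel)"
    if [measurable]: "A \<in> sets borel" and t: "0 < t" for A t
  proof -
    have "(\<integral>\<^sup>+h. ennreal (t * b * s * w h) * indicator A h \<partial>lborel)
        = (\<integral>\<^sup>+h. ennreal (t * b * s) * (ennreal (w h) * indicator A h) \<partial>lborel)"
      using w_pos pos t by (intro nn_integral_cong) (simp add: ennreal_mult' mult.assoc)
    also have "\<dots> = ennreal (t * b * s) * (\<integral>\<^sup>+h. ennreal (w h) * indicator A h \<partial>lborel)"
      by (rule nn_integral_cmult) measurable
    finally have *: "(\<integral>\<^sup>+h. ennreal (t * b * s * w h) * indicator A h \<partial>lborel)
      = ennreal (t * b * s) * (\<integral>\<^sup>+h. ennreal (w h) * indicator A h \<partial>lborel)" .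
    have "ennreal (t * D) * ennreal g = ennreal k * ennreal (t * b * s)"
      using pos k t by (simp add: D_def flip: ennreal_mult')
    then show ?thesis by (simp add: N * flip: mult.assoc)
  qed
  have mass: "(\<integral>\<^sup>+z. L z * indicator A (c *\<^sub>R (fst z - \<theta>0)) \<partial>(Q \<Otimes>\<^sub>M R)) =
    ennreal k * (\<integral>\<^sup>+h. ennreal (f (\<theta>0 + h /\<^sub>R c)) * (\<integral>\<^sup>+\<eta>. L (\<theta>0 + h /\<^sub>R c, \<eta>) \<partial>R) * indicator A h \<partial>lborel)"
    if "A \<in> sets borel" "A \<subseteq> K" for A
    unfolding k_def
    by (rule nn_integral_rescaled_product_prior[OF _ open_param sets_Q U f dens L c that(1)])
       (use that KU R.sigma_finite_measure_axioms in auto)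
  show ?thesis
  proof (rule that[OF D])
    fix A assume A: "A \<in> sets borel" "A \<subseteq> K"
    have lo: "ennreal (exp (- (2 * a)) * b * s * w h) \<le> ennreal (f (\<theta>0 + h /\<^sub>R c)) * (\<integral>\<^sup>+\<eta>. L (\<theta>0 + h /\<^sub>R c, \<eta>) \<partial>R)"
      if "h \<in> K" for h
    proof -
      have "exp (- (2 * a)) * b * s * w h = (exp (- a) * b) * (exp (- a) * s * w h)"
        by (simp add: mult_ac flip: exp_add)
      then have "ennreal (exp (- (2 * a)) * b * s * w h) = ennreal ((exp (- a) * b) * (exp (- a) * s * w h))"
        by (rule arg_cong)
      also have "\<dots> = ennreal (exp (- a) * b) * ennreal (exp (- a) * s * w h)"
        using pos by (intro ennreal_mult') simp
      also have "\<dots> \<le> ennreal (f (\<theta>0 + h /\<^sub>R c)) * (\<integral>\<^sup>+\<eta>. L (\<theta>0 + h /\<^sub>R c, \<eta>) \<partial>R)"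
        using that by (intro mult_mono ennreal_leI f_bounds L_bounds) auto
      finally show ?thesis .
    qed
    have up: "ennreal (f (\<theta>0 + h /\<^sub>R c)) * (\<integral>\<^sup>+\<eta>. L (\<theta>0 + h /\<^sub>R c, \<eta>) \<partial>R) \<le> ennreal (exp (2 * a) * b * s * w h)"
      if "h \<in> K" for h
    proof -
      have "ennreal (f (\<theta>0 + h /\<^sub>R c)) * (\<integral>\<^sup>+\<eta>. L (\<theta>0 + h /\<^sub>R c, \<eta>) \<partial>R) \<le> ennreal (exp a * b) * ennreal (exp a * s * w h)"
        using that by (intro mult_mono ennreal_leI f_bounds L_bounds) auto
      also have "\<dots> = ennreal ((exp a * b) * (exp a * s * w h))"
        using pos by (intro ennreal_mult'[symmetric]) simp
      also have "(exp a * b) * (exp a * s * w h) = exp (2 * a) * b * s * w h"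
        by (simp add: mult_ac flip: exp_add)
      finally show ?thesis .
    qed
    show "ennreal (exp (- (2 * a)) * D) * emeasure N A \<le> (\<integral>\<^sup>+z. L z * indicator A (c *\<^sub>R (fst z - \<theta>0)) \<partial>(Q \<Otimes>\<^sub>M R))"
      unfolding mass[OF A] DN[OF A(1) exp_gt_zero] using lo A
      by (intro mult_left_mono nn_integral_mono) (auto simp: indicator_def)
    show "(\<integral>\<^sup>+z. L z * indicator A (c *\<^sub>R (fst z - \<theta>0)) \<partial>(Q \<Otimes>\<^sub>M R)) \<le> ennreal (exp (2 * a) * D) * emeasure N A"
      unfolding mass[OF A] DN[OF A(1) exp_gt_zero] using up A
      by (intro mult_left_mono nn_integral_mono) (auto simp: indicator_def)
  qed
qed

text \<open>
  Dividing the previous bounds by the marginal likelihood only changes \<open>D\<close>, so the comparison of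
  nearly proportional probability measures applies. The marginal likelihood is positive because the
  normal law charges \<open>K\<close>, and then so does the unnormalised posterior.
\<close>

lemma rescaled_posterior_close:
  fixes w :: "'a \<Rightarrow> real" and a b c e g s :: real
  assumes L [measurable]: "L \<in> borel_measurable (Q \<Otimes>\<^sub>M R)" and c: "0 < c"
    and finite: "(\<integral>\<^sup>+z. L z \<partial>(Q \<Otimes>\<^sub>M R)) < \<infinity>"
    and K [measurable]: "K \<in> sets borel"
    and KU: "\<And>h. h \<in> K \<Longrightarrow> \<theta>0 + h /\<^sub>R c \<in> U"
    and pos: "0 < b" "0 < g" "0 < s" and a: "0 \<le> a" and e: "e < 1"
    and f_bounds: "\<And>h. h \<in> K \<Longrightarrow> exp (- a) * b \<le> f (\<theta>0 + h /\<^sub>R c)"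
      "\<And>h. h \<in> K \<Longrightarrow> f (\<theta>0 + h /\<^sub>R c) \<le> exp a * b"
    and L_bounds: "\<And>h. h \<in> K \<Longrightarrow> ennreal (exp (- a) * s * w h) \<le> (\<integral>\<^sup>+\<eta>. L (\<theta>0 + h /\<^sub>R c, \<eta>) \<partial>R)"
      "\<And>h. h \<in> K \<Longrightarrow> (\<integral>\<^sup>+\<eta>. L (\<theta>0 + h /\<^sub>R c, \<eta>) \<partial>R) \<le> ennreal (exp a * s * w h)"
    and w: "w \<in> borel_measurable borel" "\<And>h. 0 \<le> w h"
    and N: "prob_space N" "sets N = sets borel"
    and N_dens: "\<And>A. A \<in> sets borel \<Longrightarrow> emeasure N A = ennreal g * (\<integral>\<^sup>+h. ennreal (w h) * indicator A h \<partial>lborel)"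
    and tails: "measure (rescaled_posterior (Q \<Otimes>\<^sub>M R) \<theta>0 c L) (- K) \<le> e" "measure N (- K) \<le> e"
    and B: "B \<in> sets borel"
  shows "\<bar>measure (rescaled_posterior (Q \<Otimes>\<^sub>M R) \<theta>0 c L) B - measure N B\<bar> \<le> exp (4 * a) / (1 - e) - 1 + e"
proof -
  interpret N: prob_space N by fact
  have spN: "space N = UNIV" using sets_eq_imp_space_eq[OF N(2)] by simp
  let ?P = "rescaled_posterior (Q \<Otimes>\<^sub>M R) \<theta>0 c L"
  let ?J = "\<lambda>A. \<integral>\<^sup>+z. L z * indicator A (c *\<^sub>R (fst z - \<theta>0)) \<partial>(Q \<Otimes>\<^sub>M R)"
  let ?m = "\<integral>\<^sup>+z. L z \<partial>(Q \<Otimes>\<^sub>M R)"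
  have sP: "sets ?P = sets borel" "space ?P = UNIV" by (simp_all add: rescaled_posterior_def)
  obtain D where D: "0 < D"
    and lo: "\<And>A. A \<in> sets borel \<Longrightarrow> A \<subseteq> K \<Longrightarrow> ennreal (exp (- (2 * a)) * D) * emeasure N A \<le> ?J A"
    and up: "\<And>A. A \<in> sets borel \<Longrightarrow> A \<subseteq> K \<Longrightarrow> ?J A \<le> ennreal (exp (2 * a) * D) * emeasure N A"
    using likelihood_mass_proportional[OF L c KU pos f_bounds L_bounds w N_dens] by blast
  have "0 < emeasure N K"
    using tails(2) e N.prob_compl[of K] by (simp add: spN N Compl_eq_Diff_UNIV N.emeasure_eq_measure)
  then have "0 < ?J K" using lo[of K] D by (auto simp: ennreal_zero_less_mult_iff order.strict_iff_not)
  also have "?J K \<le> ?m" by (intro nn_integral_mono) (auto simp: indicator_def)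
  finally have m_pos: "0 < ?m" .
  with finite obtain m where m: "?m = ennreal m" "0 < m"
    by (cases ?m) auto
  interpret P: prob_space ?P
  proof
    show "emeasure ?P (space ?P) = 1"
      using m_pos finite by (simp add: sP emeasure_rescaled_posterior)
  qed
  have real_le: "measure ?P A \<le> t / m * measure N A" if "A \<in> sets borel" "?J A \<le> ennreal t * emeasure N A" "0 \<le> t" for A t
  proof -
    have "ennreal (measure ?P A) \<le> ennreal t * emeasure N A / ennreal m"
      using that by (simp add: emeasure_rescaled_posterior m divide_right_mono_ennreal flip: P.emeasure_eq_measure)
    also have "\<dots> = ennreal (t / m * measure N A)"
      using that m by (simp add: N.emeasure_eq_measure divide_ennreal flip: ennreal_mult')
    finally show ?thesis using that m by simp
  qed
  have real_ge: "t / m * measure N A \<le> measure ?P A" if "A \<in> sets borel" "ennreal t * emeasure N A \<le> ?J A" "0 \<le> t" for A t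
  proof -
    have "ennreal (t / m * measure N A) = ennreal t * emeasure N A / ennreal m"
      using that m by (simp add: N.emeasure_eq_measure divide_ennreal flip: ennreal_mult')
    also have "\<dots> \<le> ennreal (measure ?P A)"
      using that by (simp add: emeasure_rescaled_posterior m divide_right_mono_ennreal flip: P.emeasure_eq_measure)
    finally show ?thesis by simp
  qed
  have "\<bar>measure ?P B - measure N B\<bar> \<le> exp (2 * (2 * a)) / (1 - e) - 1 + e"
  proof (rule prob_close_if_proportional_on_large_set[where K=K and D="D / m"])
    show "exp (- (2 * a)) * (D / m) * measure N A \<le> measure ?P A" if "A \<in> sets N" "A \<subseteq> K" for A
      using real_ge[OF _ lo] that D by (simp add: N)
    show "measure ?P A \<le> exp (2 * a) * (D / m) * measure N A" if "A \<in> sets N" "A \<subseteq> K" for A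
      using real_le[OF _ up] that D by (simp add: N)
  qed (use tails a e B P.prob_space_axioms in \<open>simp_all add: N sP spN Compl_eq_Diff_UNIV\<close>)
  then show ?thesis by simp
qed

end

section \<open>The posterior of one experiment\<close>

definition likelihood :: "('a \<Rightarrow> 'h \<Rightarrow> 'x \<Rightarrow> real) \<Rightarrow> 'x \<Rightarrow> 'a \<times> 'h \<Rightarrow> ennreal"
  where "likelihood q x = (\<lambda>(\<theta>, \<eta>). ennreal (q \<theta> \<eta> x))"

text \<open>
  One member of the sequence of experiments, with dominating measure \<open>M\<close> and densities \<open>q\<close>.
\<close>

locale bayes_experiment = thick_product_prior \<Theta> U f Q R
  for \<Theta> U :: "'a::euclidean_space set" and f :: "'a \<Rightarrow> real" and Q :: "'a measure" and R :: "'h measure" +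
  fixes M :: "'x measure" and q :: "'a \<Rightarrow> 'h \<Rightarrow> 'x \<Rightarrow> real"
  assumes sigma_finite_M: "sigma_finite_measure M"
    and joint_measurable: "(\<lambda>(x, \<theta>, \<eta>). q \<theta> \<eta> x) \<in> borel_measurable (M \<Otimes>\<^sub>M (Q \<Otimes>\<^sub>M R))"
    and prob_model: "\<And>\<theta> \<eta>. \<theta> \<in> \<Theta> \<Longrightarrow> \<eta> \<in> space R \<Longrightarrow> prob_space (density M (\<lambda>x. ennreal (q \<theta> \<eta> x)))"
begin

lemma space_Q: "space Q = \<Theta>"
  using sets_eq_imp_space_eq[OF sets_Q] by (simp add: space_restrict_space)

lemma joint_measurable' [measurable]: "(\<lambda>w. likelihood q (fst w) (snd w)) \<in> borel_measurable (M \<Otimes>\<^sub>M (Q \<Otimes>\<^sub>M R))"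
  using joint_measurable by (simp add: likelihood_def split_beta')

lemma measurable_likelihood [measurable]: "x \<in> space M \<Longrightarrow> likelihood q x \<in> borel_measurable (Q \<Otimes>\<^sub>M R)"
  using measurable_compose[OF measurable_Pair1' joint_measurable'] by simp

lemma measurable_density: "\<theta> \<in> \<Theta> \<Longrightarrow> \<eta> \<in> space R \<Longrightarrow> (\<lambda>x. ennreal (q \<theta> \<eta> x)) \<in> borel_measurable M"
  using measurable_compose[OF measurable_Pair2' joint_measurable', of "(\<theta>, \<eta>)"]
  by (simp add: likelihood_def space_pair_measure space_Q)

lemma sigma_finite_prior: "sigma_finite_measure (Q \<Otimes>\<^sub>M R)"
proof -
  interpret Q: prob_space Q by (rule prob_Q)
  interpret R: prob_space R by (rule prob_R)
  interpret pair_prob_space Q R ..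
  show ?thesis by (rule sigma_finite_measure_axioms)
qed

text \<open>
  By Fubini the marginal likelihood integrates to one, being a mixture of probability densities.
\<close>

lemma marginal_likelihood_finite: "AE x in M. (\<integral>\<^sup>+z. likelihood q x z \<partial>(Q \<Otimes>\<^sub>M R)) < \<infinity>"
proof -
  interpret Q: prob_space Q by (rule prob_Q)
  interpret R: prob_space R by (rule prob_R)
  interpret QR: pair_prob_space Q R by standard
  interpret M: sigma_finite_measure M by (rule sigma_finite_M)
  interpret MQR: pair_sigma_finite M "Q \<Otimes>\<^sub>M R"
    by (intro pair_sigma_finite.intro sigma_finite_M sigma_finite_prior)
  have m [measurable]: "(\<lambda>x. \<integral>\<^sup>+z. likelihood q x z \<partial>(Q \<Otimes>\<^sub>M R)) \<in> borel_measurable M"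
    by (rule QR.borel_measurable_nn_integral) (use joint_measurable' in \<open>simp add: split_beta'\<close>)
  have "(\<integral>\<^sup>+x. \<integral>\<^sup>+z. likelihood q x z \<partial>(Q \<Otimes>\<^sub>M R) \<partial>M) = (\<integral>\<^sup>+z. \<integral>\<^sup>+x. likelihood q x z \<partial>M \<partial>(Q \<Otimes>\<^sub>M R))"
    by (rule MQR.Fubini'[symmetric, of "\<lambda>x z. likelihood q x z"]) (use joint_measurable' in \<open>simp add: split_beta'\<close>)
  also have "\<dots> = (\<integral>\<^sup>+z. 1 \<partial>(Q \<Otimes>\<^sub>M R))"
  proof (rule nn_integral_cong)
    fix z assume "z \<in> space (Q \<Otimes>\<^sub>M R)"
    then have z: "fst z \<in> \<Theta>" "snd z \<in> space R" by (auto simp: space_pair_measure space_Q)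
    interpret D: prob_space "density M (\<lambda>x. ennreal (q (fst z) (snd z) x))" by (rule prob_model[OF z])
    show "(\<integral>\<^sup>+x. likelihood q x z \<partial>M) = 1"
      using D.emeasure_space_1 measurable_density[OF z] by (simp add: likelihood_def split_beta emeasure_density)
  qed
  also have "\<dots> = 1" using QR.emeasure_space_1 by simp
  finally have "(\<integral>\<^sup>+x. \<integral>\<^sup>+z. likelihood q x z \<partial>(Q \<Otimes>\<^sub>M R) \<partial>M) \<noteq> \<infinity>" by simp
  from nn_integral_PInf_AE[OF m this] show ?thesis
    by eventually_elim (simp only: less_top infinity_ennreal_def)
qed

lemma posterior_prob_eq_rescaled:
  assumes p: "p n = q" and \<Pi>H: "\<Pi>H n = R" and x: "x \<in> space M" and B [measurable]: "B \<in> sets borel"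
  shows "posterior_prob p Q \<Pi>H n (\<lambda>\<theta>. c *\<^sub>R (\<theta> - \<theta>0) \<in> B) x = measure (rescaled_posterior (Q \<Otimes>\<^sub>M R) \<theta>0 c (likelihood q x)) B"
proof -
  have "measure (rescaled_posterior (Q \<Otimes>\<^sub>M R) \<theta>0 c (likelihood q x)) B = measure (density (Q \<Otimes>\<^sub>M R) (\<lambda>z. likelihood q x z / (\<integral>\<^sup>+z. likelihood q x z \<partial>(Q \<Otimes>\<^sub>M R))))
     ((\<lambda>z. c *\<^sub>R (fst z - \<theta>0)) -` B \<inter> space (Q \<Otimes>\<^sub>M R))"
    unfolding rescaled_posterior_def by (subst measure_distr) simp_all
  also have "(\<lambda>z. c *\<^sub>R (fst z - \<theta>0)) -` B \<inter> space (Q \<Otimes>\<^sub>M R) = {z \<in> space (Q \<Otimes>\<^sub>M R). c *\<^sub>R (fst z - \<theta>0) \<in> B}" by auto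
  finally show ?thesis
    by (simp add: posterior_prob_def posterior_def p \<Pi>H likelihood_def split_beta')
qed

text \<open>
  At sample points with a degenerate marginal likelihood the posterior is the null measure, so only
  the bound by one holds in general.
\<close>

lemma rescaled_posterior_le_1:
  assumes x: "x \<in> space M"
  shows "measure (rescaled_posterior (Q \<Otimes>\<^sub>M R) \<theta>0 c (likelihood q x)) B \<le> 1"
proof (cases "B \<in> sets borel")
  case True
  note [measurable] = True x
  have "emeasure (rescaled_posterior (Q \<Otimes>\<^sub>M R) \<theta>0 c (likelihood q x)) B \<le> (\<integral>\<^sup>+z. likelihood q x z \<partial>(Q \<Otimes>\<^sub>M R)) / (\<integral>\<^sup>+z. likelihood q x z \<partial>(Q \<Otimes>\<^sub>M R))"
    unfolding emeasure_rescaled_posterior[OF measurable_likelihood[OF x] True]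
    by (intro divide_right_mono_ennreal nn_integral_mono) (auto simp: indicator_def)
  also have "\<dots> \<le> 1"
  proof -
    have "m / m \<le> 1" for m :: ennreal
      using ennreal_divide_self[of m] by (cases "m = 0 \<or> m = \<top>") (auto simp: top.not_eq_extremum)
    then show ?thesis .
  qed
  finally show ?thesis by (simp add: measure_def enn2real_leI)
next
  case False
  then show ?thesis by (simp add: measure_notin_sets rescaled_posterior_def)
qed

lemma measurable_rescaled_posterior:
  assumes B [measurable]: "B \<in> sets borel"
  shows "(\<lambda>x. measure (rescaled_posterior (Q \<Otimes>\<^sub>M R) \<theta>0 c (likelihood q x)) B) \<in> borel_measurable M"
proof -
  interpret sigma_finite_measure "Q \<Otimes>\<^sub>M R" by (rule sigma_finite_prior)
  have [measurable]: "(\<lambda>w. c *\<^sub>R (fst (snd w) - \<theta>0)) \<in> borel_measurable (M \<Otimes>\<^sub>M (Q \<Otimes>\<^sub>M R))"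
    using measurable_compose[OF measurable_snd measurable_rescale] by simp
  have m1: "(\<lambda>x. \<integral>\<^sup>+z. likelihood q x z \<partial>(Q \<Otimes>\<^sub>M R)) \<in> borel_measurable M"
    by (rule borel_measurable_nn_integral) (use joint_measurable' in \<open>simp add: split_beta'\<close>)
  have m2: "(\<lambda>x. \<integral>\<^sup>+z. likelihood q x z * indicator B (c *\<^sub>R (fst z - \<theta>0)) \<partial>(Q \<Otimes>\<^sub>M R)) \<in> borel_measurable M"
    by (rule borel_measurable_nn_integral) (simp add: split_beta')
  have "(\<lambda>x. enn2real ((\<integral>\<^sup>+z. likelihood q x z * indicator B (c *\<^sub>R (fst z - \<theta>0)) \<partial>(Q \<Otimes>\<^sub>M R)) / (\<integral>\<^sup>+z. likelihood q x z \<partial>(Q \<Otimes>\<^sub>M R)))) \<in> borel_measurable M"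
    using m1 m2 by measurable
  then show ?thesis
    by (subst measurable_cong) (auto simp: measure_def emeasure_rescaled_posterior)
qed

end

section \<open>Outer probability, diverging tails and the expansion of the likelihood\<close>

lemma outer_measure_of_Un_le:
  assumes "A \<subseteq> space M" "B \<subseteq> space M"
  shows "outer_measure_of M (A \<union> B) \<le> outer_measure_of M A + outer_measure_of M B"
proof -
  obtain A' B' where *: "A' \<in> sets M" "A \<subseteq> A'" "outer_measure_of M A = emeasure M A'"
    "B' \<in> sets M" "B \<subseteq> B'" "outer_measure_of M B = emeasure M B'"
    using outer_measure_of_attain[OF assms(1)] outer_measure_of_attain[OF assms(2)] by blast
  have "outer_measure_of M (A \<union> B) \<le> outer_measure_of M (A' \<union> B')"
    using * by (intro outer_measure_of_mono) auto
  also have "\<dots> = emeasure M (A' \<union> B')" using * by (intro outer_measure_of_eq) auto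
  also have "\<dots> \<le> emeasure M A' + emeasure M B'" using * by (intro emeasure_subadditive)
  finally show ?thesis using * by simp
qed

lemma tendsto_zero_ennrealI:
  fixes u :: "nat \<Rightarrow> ennreal"
  assumes "\<And>e. 0 < e \<Longrightarrow> \<forall>\<^sub>F n in sequentially. u n \<le> ennreal e"
  shows "u \<longlonglongrightarrow> 0"
proof (rule order_tendstoI)
  fix a :: ennreal assume "0 < a"
  then obtain b where b: "0 < b" "b < a" using dense by blast
  then obtain e where e: "b = ennreal e" "0 < e" by (cases b) auto
  show "\<forall>\<^sub>F n in sequentially. u n < a"
    using assms[OF e(2)] by eventually_elim (use b e in auto)
qed simp

text \<open>
  If no fixed level works, there are indices \<open>r(0) < r(1) < \<dots>\<close> at which the tails beyond
  \<open>k\<^sub>0, k\<^sub>0 + 1, \<dots>\<close> are at least \<open>e\<close>. Using these levels at the indices \<open>r(k)\<close>, and the level \<open>n\<close> at all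
  others, gives a diverging sequence of levels along which the tails do not vanish.
\<close>

lemma eventually_small_tail_beyond_fixed_level:
  fixes u :: "nat \<Rightarrow> real \<Rightarrow> real"
  assumes u: "\<And>M :: nat \<Rightarrow> real. filterlim M at_top sequentially \<Longrightarrow> (\<lambda>n. u n (M n)) \<longlonglongrightarrow> 0"
    and e: "0 < e"
  obtains k where "k0 \<le> k" "\<forall>\<^sub>F n in sequentially. u n k < e"
proof (rule ccontr)
  note result = that
  assume "\<not> thesis"
  then have no: "\<not> (\<forall>\<^sub>F n in sequentially. u n k < e)" if "k0 \<le> k" for k using that result by blast
  have "\<exists>n>N. e \<le> u n (k0 + real k)" for N k
    using no[of "k0 + real k"] by (auto simp: not_eventually frequently_sequentially not_less dest: spec[of _ "Suc N"] intro: Suc_le_lessD)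
  then have "\<exists>r. \<forall>k. e \<le> u (r k) (k0 + real k) \<and> r k < r (Suc k)"
    by (intro dependent_nat_choice) blast+
  then obtain r where r: "\<And>k. e \<le> u (r k) (k0 + real k)" "strict_mono r"
    by (auto simp: strict_mono_Suc_iff)
  define M where "M n = (if n \<in> range r then k0 + real (inv r n) else real n)" for n
  have Mr: "M (r k) = k0 + real k" for k
    using r(2) by (simp add: M_def strict_mono_imp_inj_on)
  have "filterlim M at_top sequentially"
    unfolding filterlim_at_top eventually_sequentially
  proof
    fix Z
    obtain k where k: "Z \<le> real k" "Z \<le> k0 + real k"
      using real_arch_simple[of "max Z (Z - k0)"] by auto
    have "Z \<le> M n" if "max k (r k) \<le> n" for n
    proof (cases "n \<in> range r")
      case True
      then obtain j where j: "n = r j" by auto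
      then have "k \<le> j" using that r(2) by (simp add: strict_mono_less_eq)
      then show ?thesis using k by (simp add: j Mr)
    qed (use that k in \<open>simp add: M_def\<close>)
    then show "\<exists>N. \<forall>n\<ge>N. Z \<le> M n" by blast
  qed
  from u[OF this] have "((\<lambda>n. u n (M n)) \<circ> r) \<longlonglongrightarrow> 0" using r(2) by (rule LIMSEQ_subseq_LIMSEQ)
  then have "\<forall>\<^sub>F k in sequentially. u (r k) (k0 + real k) < e"
    using e by (auto simp: o_def Mr dest: order_tendstoD(2)[of _ _ _ e])
  then obtain k where "u (r k) (k0 + real k) < e" by (auto simp: eventually_sequentially)
  with r(1)[of k] show False by simp
qed

lemma small_accuracy_exists:
  fixes d :: real
  assumes "0 < d"
  obtains a where "0 < a" "a < 1" "exp (4 * a) / (1 - a) - 1 + a \<le> d"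
proof -
  have "((\<lambda>a. exp (4 * a) / (1 - a) - 1 + a) \<longlongrightarrow> exp (4 * 0) / (1 - 0) - 1 + 0) (at_right (0::real))"
    by (intro tendsto_intros) auto
  then have "\<forall>\<^sub>F a in at_right 0. exp (4 * a) / (1 - a) - 1 + a < d"
    using assms by (intro order_tendstoD(2)) auto
  moreover have "\<forall>\<^sub>F a in at_right (0::real). a \<in> {0<..<1}"
    by (rule eventually_at_right_real) simp
  ultimately have "\<forall>\<^sub>F a in at_right (0::real). 0 < a \<and> a < 1 \<and> exp (4 * a) / (1 - a) - 1 + a \<le> d"
    by eventually_elim auto
  then show ?thesis using that by (auto dest: eventually_happens)
qed

text \<open>
  A finite bound on the extended logarithm excludes all degenerate values of the ratio. This is how
  the expansion yields that the integrated likelihood at the centre is positive and finite.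
\<close>

lemma ratio_bounds_of_ln_ennreal:
  assumes le: "e2ennreal \<bar>ln_ennreal (a / b) - ereal u + ereal v\<bar> \<le> ennreal e" and "0 \<le> e"
  shows "0 < b" "b < \<top>" "ennreal (exp (- e) * exp (u - v)) * b \<le> a" "a \<le> ennreal (exp e * exp (u - v)) * b"
proof -
  let ?y = "\<bar>ln_ennreal (a / b) - ereal u + ereal v\<bar>"
  have "?y = enn2ereal (e2ennreal ?y)" by (simp add: enn2ereal_e2ennreal)
  also have "\<dots> \<le> enn2ereal (ennreal e)" using le by (simp add: less_eq_ennreal.rep_eq)
  finally have y: "?y \<le> ereal e" using \<open>0 \<le> e\<close> by (simp add: enn2ereal_ennreal)
  have ne: "a / b \<noteq> 0" "a / b \<noteq> \<top>"
  proof -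
    have "q \<noteq> 0 \<and> q \<noteq> \<top>" if "\<bar>ln_ennreal q - ereal u + ereal v\<bar> \<le> ereal e" for q
      using that by (auto simp: ln_ennreal_def)
    from this[OF y] show "a / b \<noteq> 0" "a / b \<noteq> \<top>" by auto
  qed
  then obtain r where r: "a / b = ennreal r" "0 < r"
    by (cases "a / b") (auto simp: less_le)
  show b: "0 < b" using ne by (cases "b = 0") (auto simp: zero_less_iff_neq_zero split: if_splits)
  show b': "b < \<top>" using ne by (cases "b = \<top>") (auto simp: top.not_eq_extremum)
  have a: "a = ennreal r * b"
    using b b' r(1) by (metis ennreal_divide_times ennreal_times_divide mult_divide_eq_ennreal not_gr_zero less_irrefl mult.commute infinity_ennreal_def)
  have "\<bar>ln r - u + v\<bar> \<le> e" using y r by (simp add: ln_ennreal_def)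
  then have "- e + (u - v) \<le> ln r" "ln r \<le> e + (u - v)" by auto
  then have "exp (- e + (u - v)) \<le> r" "r \<le> exp (e + (u - v))"
    using r(2) by (metis exp_le_cancel_iff exp_ln)+
  then show "ennreal (exp (- e) * exp (u - v)) * b \<le> a" "a \<le> ennreal (exp e * exp (u - v)) * b"
    unfolding a exp_add by (auto intro!: mult_right_mono ennreal_leI)
qed

section \<open>Posterior normality\<close>

theorem theorem3p1p1:
  fixes \<Theta> :: "(real ^ 'p) set"
    and H :: "'h set"
    and \<mu> :: "nat \<Rightarrow> 'x measure"
    and p :: "nat \<Rightarrow> real ^ 'p \<Rightarrow> 'h \<Rightarrow> 'x \<Rightarrow> real"
    and \<Pi>\<Theta> :: "(real ^ 'p) measure"
    and \<Pi>H :: "nat \<Rightarrow> 'h measure"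
    and \<theta>0 :: "real ^ 'p"
    and \<eta>0 :: 'h
    and \<Delta> :: "nat \<Rightarrow> 'x \<Rightarrow> real ^ 'p"
    and V :: "nat \<Rightarrow> real ^ 'p ^ 'p"
    and P0 :: "nat \<Rightarrow> 'x measure"
  assumes "open \<Theta>" and "\<theta>0 \<in> \<Theta>" and "\<eta>0 \<in> H"
    and "\<And>n. sigma_finite_measure (\<mu> n)"
    and "\<And>n \<theta> \<eta> x. \<theta> \<in> \<Theta> \<Longrightarrow> \<eta> \<in> H \<Longrightarrow> x \<in> space (\<mu> n) \<Longrightarrow> 0 \<le> p n \<theta> \<eta> x"
    and "\<And>n \<theta> \<eta>. \<theta> \<in> \<Theta> \<Longrightarrow> \<eta> \<in> H \<Longrightarrow> prob_space (model_law \<mu> p n \<theta> \<eta>)"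
    and "\<And>n. P0 n = model_law \<mu> p n \<theta>0 \<eta>0"
    and "prob_space \<Pi>\<Theta>" and "sets \<Pi>\<Theta> = sets (restrict_space borel \<Theta>)"
    and "\<And>n. prob_space (\<Pi>H n)" and "\<And>n. space (\<Pi>H n) = H"
    and "\<And>n. (\<lambda>(x, \<theta>, \<eta>). p n \<theta> \<eta> x) \<in> borel_measurable (\<mu> n \<Otimes>\<^sub>M (\<Pi>\<Theta> \<Otimes>\<^sub>M \<Pi>H n))"
    and "thick_at \<Pi>\<Theta> \<theta>0"
    and "\<And>M :: nat \<Rightarrow> real. filterlim M at_top sequentially \<Longrightarrow>
      (\<lambda>n. \<integral>x. posterior_prob p \<Pi>\<Theta> \<Pi>H n (\<lambda>\<theta>. sqrt (real n) * norm (\<theta> - \<theta>0) > M n) x \<partial>P0 n)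
        \<longlonglongrightarrow> 0"
    and "\<And>n. \<Delta> n \<in> borel_measurable (\<mu> n)" and "uniformly_tight P0 \<Delta>"
    and "\<And>n. positive_definite (V n)"
    and "liminf (\<lambda>n. ereal (min_eigenvalue (V n))) > 0"
    and "\<And>K :: (real ^ 'p) set. compact K \<Longrightarrow>
      tendsto_zero_in_outer_prob P0 (\<lambda>n x. SUP h\<in>K. e2ennreal
        \<bar>ln_ennreal (integrated_likelihood p \<Pi>H \<theta>0 \<eta>0 n h x / integrated_likelihood p \<Pi>H \<theta>0 \<eta>0 n 0 x)
          - ereal (h \<bullet> (V n *v \<Delta> n x)) + ereal (1 / 2 * (h \<bullet> (V n *v h)))\<bar>)"
  shows "tendsto_zero_in_outer_prob P0 (\<lambda>n x. SUP B\<in>sets (borel :: (real ^ 'p) measure). ennreal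
      \<bar>posterior_prob p \<Pi>\<Theta> \<Pi>H n (\<lambda>\<theta>. sqrt (real n) *\<^sub>R (\<theta> - \<theta>0) \<in> B) x
        - measure (multivariate_normal (\<Delta> n x) (matrix_inv (V n))) B\<bar>)"
proof -
  from \<open>thick_at \<Pi>\<Theta> \<theta>0\<close> obtain U f where U: "open U" "\<theta>0 \<in> U" "U \<subseteq> space \<Pi>\<Theta>"
    and f: "continuous_on U f" "\<And>\<theta>. \<theta> \<in> U \<Longrightarrow> 0 < f \<theta>"
    and dens: "\<And>A. A \<in> sets borel \<Longrightarrow> A \<subseteq> U \<Longrightarrow>
      emeasure \<Pi>\<Theta> A = (\<integral>\<^sup>+\<theta>. ennreal (f \<theta>) * indicator A \<theta> \<partial>lborel)"
    unfolding thick_at_def by blast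
  have "space \<Pi>\<Theta> = \<Theta>"
    using sets_eq_imp_space_eq[OF assms(9)] by (simp add: space_restrict_space)
  with U have U\<Theta>: "U \<subseteq> \<Theta>" by simp
  have prior: "thick_product_prior \<Theta> U f \<Pi>\<Theta> (\<Pi>H n)" for n
    by (rule thick_product_prior.intro[OF assms(1,9,8,10) U(1) U\<Theta> f(1) dens])
  have expm: "bayes_experiment \<Theta> U f \<Pi>\<Theta> (\<Pi>H n) (\<mu> n) (p n)" for n
  proof (intro bayes_experiment.intro bayes_experiment_axioms.intro prior)
    show "sigma_finite_measure (\<mu> n)"
      "(\<lambda>(x, \<theta>, \<eta>). p n \<theta> \<eta> x) \<in> borel_measurable (\<mu> n \<Otimes>\<^sub>M (\<Pi>\<Theta> \<Otimes>\<^sub>M \<Pi>H n))" by fact+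
    show "prob_space (density (\<mu> n) (\<lambda>x. ennreal (p n \<theta> \<eta> x)))" if "\<theta> \<in> \<Theta>" "\<eta> \<in> space (\<Pi>H n)" for \<theta> \<eta>
      using assms(6)[of \<theta> \<eta> n] that assms(11) by (simp add: model_law_def)
  qed
  have P0: "P0 n = density (\<mu> n) (\<lambda>x. ennreal (p n \<theta>0 \<eta>0 x))" for n
    using assms(7) by (simp add: model_law_def)
  have prob_P0: "prob_space (P0 n)" for n using assms(2,3,6,7) by simp
  have space_P0: "space (P0 n) = space (\<mu> n)" and sets_P0 [measurable_cong]: "sets (P0 n) = sets (\<mu> n)" for n
    by (simp_all add: P0)
  have p0_measurable [measurable]: "(\<lambda>x. ennreal (p n \<theta>0 \<eta>0 x)) \<in> borel_measurable (\<mu> n)" for n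
    by (rule bayes_experiment.measurable_density[OF expm]) (use assms(2,3,11) in auto)
  \<comment> \<open>The posterior of the rescaled parameter at the sample point \<open>x\<close>.\<close>
  define post where "post n x = rescaled_posterior (\<Pi>\<Theta> \<Otimes>\<^sub>M \<Pi>H n) \<theta>0 (sqrt (real n)) (likelihood (p n) x)" for n x
  have post_eq: "posterior_prob p \<Pi>\<Theta> \<Pi>H n (\<lambda>\<theta>. sqrt (real n) *\<^sub>R (\<theta> - \<theta>0) \<in> B) x = measure (post n x) B"
    if "x \<in> space (\<mu> n)" "B \<in> sets borel" for n x B
    unfolding post_def by (rule bayes_experiment.posterior_prob_eq_rescaled[OF expm _ _ that]) (rule refl)+
  have post_measurable [measurable]: "(\<lambda>x. measure (post n x) B) \<in> borel_measurable (\<mu> n)"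
    if "B \<in> sets borel" for n B
    unfolding post_def using that by (rule bayes_experiment.measurable_rescaled_posterior[OF expm])
  have post_le_1: "measure (post n x) B \<le> 1" if "x \<in> space (\<mu> n)" for n x B
    unfolding post_def using that by (rule bayes_experiment.rescaled_posterior_le_1[OF expm])
  define tail where "tail n M = (\<integral>x. measure (post n x) (- cball 0 M) \<partial>P0 n)" for n M
  have tail: "(\<lambda>n. tail n (M n)) \<longlonglongrightarrow> 0" if "filterlim M at_top sequentially" for M
  proof -
    have "(\<integral>x. posterior_prob p \<Pi>\<Theta> \<Pi>H n (\<lambda>\<theta>. sqrt (real n) * norm (\<theta> - \<theta>0) > M n) x \<partial>P0 n) = tail n (M n)" for n
      unfolding tail_def
    proof (rule Bochner_Integration.integral_cong[OF refl])
      fix x assume "x \<in> space (P0 n)"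
      then have x: "x \<in> space (\<mu> n)" by (simp add: space_P0)
      have "(\<lambda>\<theta>. sqrt (real n) * norm (\<theta> - \<theta>0) > M n) = (\<lambda>\<theta>. sqrt (real n) *\<^sub>R (\<theta> - \<theta>0) \<in> - cball 0 (M n))"
        by (auto simp: fun_eq_iff)
      then show "posterior_prob p \<Pi>\<Theta> \<Pi>H n (\<lambda>\<theta>. sqrt (real n) * norm (\<theta> - \<theta>0) > M n) x = measure (post n x) (- cball 0 (M n))"
        using post_eq[OF x, of "- cball 0 (M n)"] by simp
    qed
    then show ?thesis using assms(14)[OF that] by simp
  qed
  \<comment> \<open>The posterior tail is measurable and bounded in \<open>x\<close>, so its expectation controls probabilities.\<close>
  have markov: "measure (P0 n) {x \<in> space (P0 n). a \<le> measure (post n x) (- cball 0 M)} \<le> tail n M / a"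
    if "0 < a" for n M a
  proof -
    interpret P: prob_space "P0 n" by (rule prob_P0)
    have "integrable (P0 n) (\<lambda>x. measure (post n x) (- cball 0 M))"
      by (rule P.integrable_const_bound[where B=1]) (auto simp: space_P0 post_le_1)
    from integral_Markov_inequality_measure[OF this, of "space (P0 n)" a] that show ?thesis
      by (simp add: tail_def)
  qed
  have regular: "AE x in P0 n. 0 < p n \<theta>0 \<eta>0 x \<and> (\<integral>\<^sup>+z. likelihood (p n) x z \<partial>(\<Pi>\<Theta> \<Otimes>\<^sub>M \<Pi>H n)) < \<infinity>" for n
    unfolding P0 using bayes_experiment.marginal_likelihood_finite[OF expm[of n]]
    by (subst AE_density) (auto elim: AE_mp)
  show ?thesis
    unfolding tendsto_zero_in_outer_prob_def
  proof (intro allI impI tendsto_zero_ennrealI)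
    fix d e :: real assume d: "0 < d" and e: "0 < e"
    obtain a where a: "0 < a" "a < 1" "exp (4 * a) / (1 - a) - 1 + a \<le> d"
      using small_accuracy_exists[OF d] by blast
    obtain c where c: "0 < c" "\<forall>\<^sub>F n in sequentially. c < min_eigenvalue (V n)"
    proof -
      obtain r :: ereal where r: "0 < r" "r < liminf (\<lambda>n. ereal (min_eigenvalue (V n)))"
        using dense[OF assms(18)] by blast
      then obtain c where "r = ereal c" by (cases r) auto
      with r less_LiminfD[OF r(2)] show ?thesis by (intro that[of c]) auto
    qed
    obtain R where R: "\<And>n. measure (P0 n) {x \<in> space (P0 n). R < norm (\<Delta> n x)} < e / 3"
      using assms(16) e unfolding uniformly_tight_def by (meson divide_pos_pos zero_less_numeral)
    obtain M0 where M0: "\<And>(V :: real ^ 'p ^ 'p) m M. positive_definite V \<Longrightarrow> c \<le> min_eigenvalue V \<Longrightarrow>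
      norm m \<le> R \<Longrightarrow> M0 \<le> M \<Longrightarrow> measure (multivariate_normal m (matrix_inv V)) (- cball 0 M) < a"
      using multivariate_normal_uniform_tail[OF c(1) a(1)] by blast
    have "0 < a * (e / 3)" using a e by simp
    then obtain k where k: "max M0 0 \<le> k" "\<forall>\<^sub>F n in sequentially. tail n k < a * (e / 3)"
      using eventually_small_tail_beyond_fixed_level[of tail, OF tail] by blast
    \<comment> \<open>Outside this ball the normal law and, with high probability, the posterior have mass at most \<open>a\<close>;
      for the normal law this needs \<open>|\<Delta>\<^sub>n| \<le> R\<close>.\<close>
    define K where "K = cball (0 :: real ^ 'p) k"
    define Z where "Z n x = (SUP h\<in>K. e2ennreal
        \<bar>ln_ennreal (integrated_likelihood p \<Pi>H \<theta>0 \<eta>0 n h x / integrated_likelihood p \<Pi>H \<theta>0 \<eta>0 n 0 x)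
          - ereal (h \<bullet> (V n *v \<Delta> n x)) + ereal (1 / 2 * (h \<bullet> (V n *v h)))\<bar>)" for n x
    have LAN: "\<forall>\<^sub>F n in sequentially. outer_measure_of (P0 n) {x \<in> space (P0 n). ennreal a < Z n x} < ennreal (e / 3)"
    proof -
      have "(\<lambda>n. outer_measure_of (P0 n) {x \<in> space (P0 n). ennreal a < Z n x}) \<longlonglongrightarrow> 0"
        using assms(19)[of K] a unfolding tendsto_zero_in_outer_prob_def Z_def K_def by auto
      then show ?thesis using e by (intro order_tendstoD(2)) auto
    qed
    have near: "\<forall>\<^sub>F n in sequentially. \<forall>h\<in>K. \<theta>0 + h /\<^sub>R sqrt (real n) \<in> U \<and>
      exp (- a) * f \<theta>0 \<le> f (\<theta>0 + h /\<^sub>R sqrt (real n)) \<and> f (\<theta>0 + h /\<^sub>R sqrt (real n)) \<le> exp a * f \<theta>0"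
    proof -
      have f0: "0 < f \<theta>0" using f U by simp
      have "isCont f \<theta>0" using f U by (simp add: continuous_on_eq_continuous_at)
      then have "(f \<longlongrightarrow> f \<theta>0) (nhds \<theta>0)" by (simp add: isCont_def tendsto_at_iff_tendsto_nhds)
      moreover have "exp (- a) * f \<theta>0 < f \<theta>0" "f \<theta>0 < exp a * f \<theta>0" using a f0 by auto
      ultimately have "\<forall>\<^sub>F \<theta> in nhds \<theta>0. exp (- a) * f \<theta>0 < f \<theta> \<and> f \<theta> < exp a * f \<theta>0 \<and> \<theta> \<in> U"
        using U by (intro eventually_conj order_tendstoD eventually_nhds_in_open) auto
      then obtain r where r: "0 < r" "\<And>\<theta>. dist \<theta> \<theta>0 < r \<Longrightarrow> exp (- a) * f \<theta>0 < f \<theta> \<and> f \<theta> < exp a * f \<theta>0 \<and> \<theta> \<in> U"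
        unfolding eventually_nhds_metric by blast
      have "(\<lambda>n. k / sqrt (real n)) \<longlonglongrightarrow> 0"
        by (intro tendsto_divide_0[OF tendsto_const] filterlim_at_top_imp_at_infinity filterlim_compose[OF sqrt_at_top] filterlim_real_sequentially)
      from order_tendstoD(2)[OF this r(1)] show ?thesis
      proof eventually_elim
        case (elim n)
        show ?case
        proof
          fix h assume h: "h \<in> K"
          have "dist (\<theta>0 + h /\<^sub>R sqrt (real n)) \<theta>0 = norm h / sqrt (real n)"
            by (simp add: dist_norm divide_inverse mult.commute)
          also have "\<dots> \<le> k / sqrt (real n)" using h by (intro divide_right_mono) (auto simp: K_def)
          finally show "\<theta>0 + h /\<^sub>R sqrt (real n) \<in> U \<and> exp (- a) * f \<theta>0 \<le> f (\<theta>0 + h /\<^sub>R sqrt (real n)) \<and>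
            f (\<theta>0 + h /\<^sub>R sqrt (real n)) \<le> exp a * f \<theta>0"
            using r(2)[of "\<theta>0 + h /\<^sub>R sqrt (real n)"] elim by auto
        qed
      qed
    qed
    show "\<forall>\<^sub>F n in sequentially. outer_measure_of (P0 n) {x \<in> space (P0 n). ennreal d < (SUP B\<in>sets (borel :: (real ^ 'p) measure). ennreal
      \<bar>posterior_prob p \<Pi>\<Theta> \<Pi>H n (\<lambda>\<theta>. sqrt (real n) *\<^sub>R (\<theta> - \<theta>0) \<in> B) x
        - measure (multivariate_normal (\<Delta> n x) (matrix_inv (V n))) B\<bar>)} \<le> ennreal e"
      using c(2) k(2) LAN near eventually_gt_at_top[of 0]
    proof eventually_elim
      case (elim n)
      interpret P: prob_space "P0 n" by (rule prob_P0)
      have sqn: "0 < sqrt (real n)" using elim by simp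
      let ?TV = "\<lambda>x. SUP B\<in>sets (borel :: (real ^ 'p) measure). ennreal
      \<bar>posterior_prob p \<Pi>\<Theta> \<Pi>H n (\<lambda>\<theta>. sqrt (real n) *\<^sub>R (\<theta> - \<theta>0) \<in> B) x
        - measure (multivariate_normal (\<Delta> n x) (matrix_inv (V n))) B\<bar>"
      \<comment> \<open>The sample points at which the expansion, the posterior tail bound or the bound on \<open>\<Delta>\<close>
        fails; a null set \<open>N\<close> will be added for degenerate likelihoods.\<close>
      let ?B1 = "{x \<in> space (P0 n). ennreal a < Z n x}"
      let ?B2 = "{x \<in> space (P0 n). a \<le> measure (post n x) (- cball 0 k)}"
      let ?B3 = "{x \<in> space (P0 n). R < norm (\<Delta> n x)}"
      have close: "\<bar>measure (post n x) B - measure (multivariate_normal (\<Delta> n x) (matrix_inv (V n))) B\<bar> \<le> d"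
        if x: "x \<in> space (\<mu> n)" "Z n x \<le> ennreal a" "measure (post n x) (- cball 0 k) \<le> a" "norm (\<Delta> n x) \<le> R"
          and reg: "0 < p n \<theta>0 \<eta>0 x" "(\<integral>\<^sup>+z. likelihood (p n) x z \<partial>(\<Pi>\<Theta> \<Otimes>\<^sub>M \<Pi>H n)) < \<infinity>"
          and B: "B \<in> sets borel" for x B
      proof -
        let ?N = "multivariate_normal (\<Delta> n x) (matrix_inv (V n))"
        \<comment> \<open>The limiting likelihood ratio; up to a constant it is also the normal density.\<close>
        define w where "w h = exp (h \<bullet> (V n *v \<Delta> n x) - 1 / 2 * (h \<bullet> (V n *v h)))" for h
        define s where "s h = integrated_likelihood p \<Pi>H \<theta>0 \<eta>0 n h x" for h
        have lik_s: "(\<integral>\<^sup>+\<eta>. likelihood (p n) x (\<theta>0 + h /\<^sub>R sqrt (real n), \<eta>) \<partial>\<Pi>H n) = ennreal (p n \<theta>0 \<eta>0 x) * s h"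
          if "h \<in> K" for h
        proof -
          let ?\<theta> = "\<theta>0 + h /\<^sub>R sqrt (real n)"
          have \<theta>: "?\<theta> \<in> \<Theta>" using elim that U\<Theta> by auto
          have m: "(\<lambda>\<eta>. likelihood (p n) x (?\<theta>, \<eta>)) \<in> borel_measurable (\<Pi>H n)"
            using \<theta> x(1) bayes_experiment.space_Q[OF expm] by (intro measurable_compose[OF measurable_Pair1' bayes_experiment.measurable_likelihood[OF expm]]) auto
          have "ennreal (p n \<theta>0 \<eta>0 x) * s h =
            ennreal (p n \<theta>0 \<eta>0 x) * (\<integral>\<^sup>+\<eta>. likelihood (p n) x (?\<theta>, \<eta>) / ennreal (p n \<theta>0 \<eta>0 x) \<partial>\<Pi>H n)"
            unfolding s_def integrated_likelihood_def local_param_def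
            using reg(1) assms(5)[OF \<theta> _ x(1)] assms(11)
            by (intro arg_cong2[where f="(*)"] refl nn_integral_cong) (simp add: likelihood_def divide_ennreal)
          also have "\<dots> = ennreal (p n \<theta>0 \<eta>0 x) * ((\<integral>\<^sup>+\<eta>. likelihood (p n) x (?\<theta>, \<eta>) \<partial>\<Pi>H n) / ennreal (p n \<theta>0 \<eta>0 x))"
            using m by (simp add: nn_integral_divide)
          also have "\<dots> = (\<integral>\<^sup>+\<eta>. likelihood (p n) x (?\<theta>, \<eta>) \<partial>\<Pi>H n)"
            using reg(1) by (simp add: ennreal_times_divide ennreal_mult_divide_eq mult.commute[of "ennreal _"])
          finally show ?thesis ..
        qed
        \<comment> \<open>The centre belongs to \<open>K\<close>, so the expansion controls \<open>s 0\<close>, too.\<close>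
        have K0: "0 \<in> K" using k by (simp add: K_def)
        have expansion: "e2ennreal \<bar>ln_ennreal (s h / s 0) - ereal (h \<bullet> (V n *v \<Delta> n x)) + ereal (1 / 2 * (h \<bullet> (V n *v h)))\<bar> \<le> ennreal a"
          if "h \<in> K" for h
          using SUP_upper[OF that, of "\<lambda>h. e2ennreal \<bar>ln_ennreal (s h / s 0) - ereal (h \<bullet> (V n *v \<Delta> n x)) + ereal (1 / 2 * (h \<bullet> (V n *v h)))\<bar>"]
            x(2) unfolding Z_def s_def by (rule order_trans)
        note ratio = ratio_bounds_of_ln_ennreal[OF expansion less_imp_le[OF a(1)], folded w_def]
        obtain t where t: "s 0 = ennreal t" "0 < t"
          using ratio(1,2)[OF K0] by (cases "s 0") auto
        obtain g where g: "0 < g" "\<And>A. A \<in> sets borel \<Longrightarrow>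
          emeasure ?N A = ennreal g * (\<integral>\<^sup>+h. ennreal (w h) * indicator A h \<partial>lborel)"
          using multivariate_normal_exponential_density[OF assms(17), of "\<Delta> n x" n] unfolding w_def by blast
        have split: "ennreal (y * (p n \<theta>0 \<eta>0 x * t) * w h) = ennreal (p n \<theta>0 \<eta>0 x) * (ennreal (y * w h) * s 0)"
          if "0 < y" for y h
          using reg(1) t that by (simp add: w_def mult_ac flip: ennreal_mult)
        have "\<bar>measure (post n x) B - measure ?N B\<bar> \<le> exp (4 * a) / (1 - a) - 1 + a"
          unfolding post_def
        proof (rule thick_product_prior.rescaled_posterior_close[OF prior, where K=K and b="f \<theta>0" and g=g and s="p n \<theta>0 \<eta>0 x * t" and w=w])
          show "ennreal (exp (- a) * (p n \<theta>0 \<eta>0 x * t) * w h) \<le> (\<integral>\<^sup>+\<eta>. likelihood (p n) x (\<theta>0 + h /\<^sub>R sqrt (real n), \<eta>) \<partial>\<Pi>H n)"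
            if "h \<in> K" for h
            unfolding lik_s[OF that] split[OF exp_gt_zero] by (intro mult_left_mono ratio(3) that) simp
          show "(\<integral>\<^sup>+\<eta>. likelihood (p n) x (\<theta>0 + h /\<^sub>R sqrt (real n), \<eta>) \<partial>\<Pi>H n) \<le> ennreal (exp a * (p n \<theta>0 \<eta>0 x * t) * w h)"
            if "h \<in> K" for h
            unfolding lik_s[OF that] split[OF exp_gt_zero] by (intro mult_left_mono ratio(4) that) simp
          show "w \<in> borel_measurable borel"
            unfolding w_def by (intro borel_measurable_continuous_onI continuous_intros matrix_vector_mult_linear_continuous_on)
          show "prob_space ?N" by (rule prob_space_multivariate_normal[OF assms(17)])
          show "measure ?N (- K) \<le> a"
            unfolding K_def using elim x(4) k by (intro less_imp_le[OF M0] assms(17)) auto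
          show "measure (rescaled_posterior (\<Pi>\<Theta> \<Otimes>\<^sub>M \<Pi>H n) \<theta>0 (sqrt (real n)) (likelihood (p n) x)) (- K) \<le> a"
            using x(3) by (simp add: K_def post_def)
          show "likelihood (p n) x \<in> borel_measurable (\<Pi>\<Theta> \<Otimes>\<^sub>M \<Pi>H n)"
            by (rule bayes_experiment.measurable_likelihood[OF expm x(1)])
          show "K \<in> sets borel" by (simp add: K_def)
          show "0 < f \<theta>0" by (rule f(2)[OF U(2)])
          show "\<theta>0 + h /\<^sub>R sqrt (real n) \<in> U" "exp (- a) * f \<theta>0 \<le> f (\<theta>0 + h /\<^sub>R sqrt (real n))"
            "f (\<theta>0 + h /\<^sub>R sqrt (real n)) \<le> exp a * f \<theta>0" if "h \<in> K" for h
            using elim that by simp_all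
          show "sets ?N = sets borel" by (simp add: multivariate_normal_def)
          show "0 < p n \<theta>0 \<eta>0 x * t" using reg(1) t by simp
          show "0 \<le> w h" for h by (simp add: w_def)
        qed (fact sqn reg(2) g less_imp_le[OF a(1)] a(2) B)+
        with a(3) show ?thesis by simp
      qed
      obtain N where N: "{x \<in> space (P0 n). \<not> (0 < p n \<theta>0 \<eta>0 x \<and> (\<integral>\<^sup>+z. likelihood (p n) x z \<partial>(\<Pi>\<Theta> \<Otimes>\<^sub>M \<Pi>H n)) < \<infinity>)} \<subseteq> N"
        "emeasure (P0 n) N = 0" "N \<in> sets (P0 n)"
        by (rule AE_E[OF regular[of n]])
      have "{x \<in> space (P0 n). ennreal d < ?TV x} \<subseteq> ?B1 \<union> (?B2 \<union> (?B3 \<union> N))"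
      proof (rule ccontr)
        assume "\<not> ?thesis"
        then obtain x where x: "x \<in> space (P0 n)" "ennreal d < ?TV x" "x \<notin> ?B1" "x \<notin> ?B2" "x \<notin> ?B3" "x \<notin> N" by blast
        have "?TV x \<le> ennreal d"
        proof (rule SUP_least)
          fix B :: "(real ^ 'p) set" assume B: "B \<in> sets borel"
          have "0 < p n \<theta>0 \<eta>0 x" "(\<integral>\<^sup>+z. likelihood (p n) x z \<partial>(\<Pi>\<Theta> \<Otimes>\<^sub>M \<Pi>H n)) < \<infinity>"
            using x(1,6) N(1) by blast+
          with B show "ennreal \<bar>posterior_prob p \<Pi>\<Theta> \<Pi>H n (\<lambda>\<theta>. sqrt (real n) *\<^sub>R (\<theta> - \<theta>0) \<in> B) x
            - measure (multivariate_normal (\<Delta> n x) (matrix_inv (V n))) B\<bar> \<le> ennreal d"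
            using x(1,3-5) by (intro ennreal_leI) (simp add: post_eq close space_P0 not_less not_le)
        qed
        with x(2) show False by simp
      qed
      then have "outer_measure_of (P0 n) {x \<in> space (P0 n). ennreal d < ?TV x} \<le> outer_measure_of (P0 n) (?B1 \<union> (?B2 \<union> (?B3 \<union> N)))"
        by (rule outer_measure_of_mono)
      also have "\<dots> \<le> outer_measure_of (P0 n) ?B1 + outer_measure_of (P0 n) (?B2 \<union> (?B3 \<union> N))"
        using sets.sets_into_space[OF N(3)] by (intro outer_measure_of_Un_le) auto
      also have "\<dots> \<le> ennreal (e / 3) + (ennreal (e / 3) + (ennreal (e / 3) + 0))"
      proof (intro add_mono)
        show "outer_measure_of (P0 n) ?B1 \<le> ennreal (e / 3)" using elim by simp
        have B3 [measurable]: "?B3 \<in> sets (P0 n)" using assms(15)[of n] by measurable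
        have B2 [measurable]: "?B2 \<in> sets (P0 n)" by measurable
        have "outer_measure_of (P0 n) (?B2 \<union> (?B3 \<union> N)) = emeasure (P0 n) (?B2 \<union> (?B3 \<union> N))"
          using B2 B3 N(3) by (intro outer_measure_of_eq) auto
        also have "\<dots> \<le> emeasure (P0 n) ?B2 + emeasure (P0 n) (?B3 \<union> N)"
          using B2 B3 N(3) by (intro emeasure_subadditive) auto
        also have "\<dots> \<le> emeasure (P0 n) ?B2 + (emeasure (P0 n) ?B3 + emeasure (P0 n) N)"
          using B2 B3 N(3) by (intro add_left_mono emeasure_subadditive) auto
        also have "\<dots> \<le> ennreal (e / 3) + (ennreal (e / 3) + 0)"
        proof (intro add_mono)
          have "tail n k / a \<le> e / 3" using elim a by (simp add: field_simps)
          then show "emeasure (P0 n) ?B2 \<le> ennreal (e / 3)"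
            unfolding P.emeasure_eq_measure by (intro ennreal_leI order_trans[OF markov[OF a(1)]])
          show "emeasure (P0 n) ?B3 \<le> ennreal (e / 3)"
            unfolding P.emeasure_eq_measure by (intro ennreal_leI less_imp_le[OF R])
        qed (simp add: N)
        finally show "outer_measure_of (P0 n) (?B2 \<union> (?B3 \<union> N)) \<le> ennreal (e / 3) + (ennreal (e / 3) + 0)" .
      qed
      also have "\<dots> = ennreal e" using e by (simp flip: ennreal_plus)
      finally show ?case .
    qed
  qed
qed

end
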